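(* Let $g: X \to Y$ be a map of simplicial sets which is a categorical weak equivalence. Then the induced functor $g_{\ast}: P(X) \to P(Y)$ of path categories is an equivalence of categories.
   Context: The path category functor $P$ from simplicial sets to small categories is the left adjoint of the nerve functor: $P(X)$ is the category freely generated by the graph of vertices and edges of $X$ subject to $d_{1}(\sigma) = d_{0}(\sigma)\cdot d_{2}(\sigma)$ for each $2$-simplex $\sigma$ and $s_{0}(x)=1_{x}$ for each vertex $x$. A quasi-category is a simplicial set $Z$ such that $Z \to \ast$ has the right lifting property with respect to all inner horn inclusions $\Lambda^{n}_{k} \subset \Delta^{n}$, $0<k<n$. Let $I$ be the nerve of the groupoid with two objects $0,1$ and exactly one morphism between any two objects. An $I$-homotopy between maps $f,g: K \to Z$ is a map $h: K \times I \to Z$ restricting to $f$ on $K \times \{0\}$ and to $g$ on $K \times \{1\}$; $\pi_{I}(K,Z)$ is the set of $I$-homotopy classes of maps $K \to Z$ (the quotient by the equivalence relation generated by $I$-homotopy). A map $f: X \to Y$ of simplicial sets is a categorical weak equivalence if $f^{\ast}: \pi_{I}(Y,Z) \to \pi_{I}(X,Z)$ is a bijection for all quasi-categories $Z$. *)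

theory Defs
  imports "HOL-Library.FuncSet" "HOL-Library.Infinite_Typeclass"
begin

section \<open>Simplicial sets\<close>

text \<open>
  A morphism \<open>[m] \<rightarrow> [n]\<close> of the simplex category is a monotone map \<open>{..m} \<rightarrow> {..n}\<close>, kept
  extensional so that equality of operators is equality of functions.
\<close>

definition simp_op :: "nat \<Rightarrow> nat \<Rightarrow> (nat \<Rightarrow> nat) set" where
  "simp_op m n = {\<theta> \<in> {..m} \<rightarrow>\<^sub>E {..n}. mono_on {..m} \<theta>}"

text \<open>
  \<open>act X m n \<theta> : X\<^sub>n \<rightarrow> X\<^sub>m\<close> is the contravariant action of \<open>\<theta> : [m] \<rightarrow> [n]\<close>.
\<close>

record 'a sset =
  simps :: "nat \<Rightarrow> 'a set"
  act :: "nat \<Rightarrow> nat \<Rightarrow> (nat \<Rightarrow> nat) \<Rightarrow> 'a \<Rightarrow> 'a"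

definition simplicial_set :: "'a sset \<Rightarrow> bool" where
  "simplicial_set X \<longleftrightarrow>
     (\<forall>m n. \<forall>\<theta>\<in>simp_op m n. act X m n \<theta> \<in> simps X n \<rightarrow> simps X m) \<and>
     (\<forall>n. \<forall>x\<in>simps X n. act X n n (\<lambda>i\<in>{..n}. i) x = x) \<and>
     (\<forall>k m n. \<forall>\<tau>\<in>simp_op k m. \<forall>\<theta>\<in>simp_op m n. \<forall>x\<in>simps X n.
        act X k n (compose {..k} \<theta> \<tau>) x = act X k m \<tau> (act X m n \<theta> x))"

definition coface :: "nat \<Rightarrow> nat \<Rightarrow> nat \<Rightarrow> nat" where
  "coface n i = (\<lambda>j\<in>{..n}. if j < i then j else Suc j)"

definition codegeneracy :: "nat \<Rightarrow> nat \<Rightarrow> nat \<Rightarrow> nat" where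
  "codegeneracy n i = (\<lambda>j\<in>{..Suc n}. if j \<le> i then j else j - 1)"

text \<open>\<open>face X n i\<close> is \<open>d\<^sub>i : X\<^sub>n\<^sub>+\<^sub>1 \<rightarrow> X\<^sub>n\<close> and \<open>degeneracy X n i\<close> is \<open>s\<^sub>i : X\<^sub>n \<rightarrow> X\<^sub>n\<^sub>+\<^sub>1\<close>.\<close>

definition face :: "'a sset \<Rightarrow> nat \<Rightarrow> nat \<Rightarrow> 'a \<Rightarrow> 'a" where
  "face X n i = act X n (Suc n) (coface n i)"

definition degeneracy :: "'a sset \<Rightarrow> nat \<Rightarrow> nat \<Rightarrow> 'a \<Rightarrow> 'a" where
  "degeneracy X n i = act X (Suc n) n (codegeneracy n i)"

definition smaps :: "'a sset \<Rightarrow> 'b sset \<Rightarrow> (nat \<Rightarrow> 'a \<Rightarrow> 'b) set" where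
  "smaps X Y = {f. (\<forall>n. f n \<in> simps X n \<rightarrow>\<^sub>E simps Y n) \<and>
     (\<forall>m n. \<forall>\<theta>\<in>simp_op m n. \<forall>x\<in>simps X n. f m (act X m n \<theta> x) = act Y m n \<theta> (f n x))}"

definition smap_comp ::
  "'a sset \<Rightarrow> (nat \<Rightarrow> 'b \<Rightarrow> 'c) \<Rightarrow> (nat \<Rightarrow> 'a \<Rightarrow> 'b) \<Rightarrow> (nat \<Rightarrow> 'a \<Rightarrow> 'c)" where
  "smap_comp X g f = (\<lambda>n. compose (simps X n) (g n) (f n))"

definition sprod :: "'a sset \<Rightarrow> 'b sset \<Rightarrow> ('a \<times> 'b) sset" where
  "sprod X Y = \<lparr>simps = (\<lambda>n. simps X n \<times> simps Y n),
     act = (\<lambda>m n \<theta>. map_prod (act X m n \<theta>) (act Y m n \<theta>))\<rparr>"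

definition spoint :: "unit sset" where
  "spoint = \<lparr>simps = (\<lambda>n. {()}), act = (\<lambda>m n \<theta> x. ())\<rparr>"

definition to_spoint :: "'a sset \<Rightarrow> nat \<Rightarrow> 'a \<Rightarrow> unit" where
  "to_spoint X n = (\<lambda>x\<in>simps X n. ())"

definition std_simplex :: "nat \<Rightarrow> (nat \<Rightarrow> nat) sset" where
  "std_simplex n = \<lparr>simps = (\<lambda>m. simp_op m n), act = (\<lambda>k m \<tau> \<theta>. compose {..k} \<theta> \<tau>)\<rparr>"

text \<open>The horn is the union of the faces \<open>d\<^sub>i\<close>, \<open>i \<noteq> k\<close>; a simplex lies in the face \<open>d\<^sub>i\<close> iff it
  misses the vertex \<open>i\<close>.\<close>

definition horn :: "nat \<Rightarrow> nat \<Rightarrow> (nat \<Rightarrow> nat) sset" where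
  "horn n k = (std_simplex n)
     \<lparr>simps := (\<lambda>m. {\<theta> \<in> simp_op m n. \<exists>i\<le>n. i \<noteq> k \<and> i \<notin> \<theta> ` {..m}})\<rparr>"

definition horn_incl :: "nat \<Rightarrow> nat \<Rightarrow> nat \<Rightarrow> (nat \<Rightarrow> nat) \<Rightarrow> (nat \<Rightarrow> nat)" where
  "horn_incl n k m = (\<lambda>\<theta>\<in>simps (horn n k) m. \<theta>)"

text \<open>\<open>has_rlp A B i Z W p\<close>: the map \<open>p : Z \<rightarrow> W\<close> has the right lifting property with respect to
  \<open>i : A \<rightarrow> B\<close>.\<close>

definition has_rlp ::
  "'a sset \<Rightarrow> 'b sset \<Rightarrow> (nat \<Rightarrow> 'a \<Rightarrow> 'b) \<Rightarrow> 'c sset \<Rightarrow> 'd sset \<Rightarrow> (nat \<Rightarrow> 'c \<Rightarrow> 'd) \<Rightarrow> bool" where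
  "has_rlp A B i Z W p \<longleftrightarrow>
     (\<forall>u\<in>smaps A Z. \<forall>v\<in>smaps B W. smap_comp A p u = smap_comp A v i \<longrightarrow>
        (\<exists>l\<in>smaps B Z. smap_comp A l i = u \<and> smap_comp B p l = v))"

definition quasi_category :: "'a sset \<Rightarrow> bool" where
  "quasi_category Z \<longleftrightarrow> simplicial_set Z \<and>
     (\<forall>n k. 0 < k \<and> k < n \<longrightarrow>
        has_rlp (horn n k) (std_simplex n) (horn_incl n k) Z spoint (to_spoint Z))"


section \<open>Categories and equivalences\<close>

text \<open>\<open>cmp C x y z g f\<close> is the composite \<open>g \<cdot> f\<close> of \<open>f : x \<rightarrow> y\<close> and \<open>g : y \<rightarrow> z\<close>. Hom-sets of different
  pairs of objects need not be disjoint.\<close>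

record ('o, 'm) cat =
  ob :: "'o set"
  hom :: "'o \<Rightarrow> 'o \<Rightarrow> 'm set"
  idt :: "'o \<Rightarrow> 'm"
  cmp :: "'o \<Rightarrow> 'o \<Rightarrow> 'o \<Rightarrow> 'm \<Rightarrow> 'm \<Rightarrow> 'm"

definition category :: "('o, 'm) cat \<Rightarrow> bool" where
  "category C \<longleftrightarrow>
     (\<forall>x\<in>ob C. idt C x \<in> hom C x x) \<and>
     (\<forall>x\<in>ob C. \<forall>y\<in>ob C. \<forall>z\<in>ob C. \<forall>f\<in>hom C x y. \<forall>g\<in>hom C y z.
        cmp C x y z g f \<in> hom C x z) \<and>
     (\<forall>x\<in>ob C. \<forall>y\<in>ob C. \<forall>f\<in>hom C x y.
        cmp C x x y f (idt C x) = f \<and> cmp C x y y (idt C y) f = f) \<and>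
     (\<forall>w\<in>ob C. \<forall>x\<in>ob C. \<forall>y\<in>ob C. \<forall>z\<in>ob C.
        \<forall>f\<in>hom C w x. \<forall>g\<in>hom C x y. \<forall>h\<in>hom C y z.
          cmp C w x z (cmp C x y z h g) f = cmp C w y z h (cmp C w x y g f))"

definition arrows :: "('o, 'm) cat \<Rightarrow> ('o \<times> 'o \<times> 'm) set" where
  "arrows C = {(x, y, f). x \<in> ob C \<and> y \<in> ob C \<and> f \<in> hom C x y}"

record ('o, 'm, 'p, 'n) functor_data =
  fob :: "'o \<Rightarrow> 'p"
  fmor :: "'o \<times> 'o \<times> 'm \<Rightarrow> 'n"

definition functors :: "('o, 'm) cat \<Rightarrow> ('p, 'n) cat \<Rightarrow> ('o, 'm, 'p, 'n) functor_data set" where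
  "functors C D = {F.
     fob F \<in> ob C \<rightarrow>\<^sub>E ob D \<and>
     fmor F \<in> (\<Pi>\<^sub>E (x, y, f)\<in>arrows C. hom D (fob F x) (fob F y)) \<and>
     (\<forall>x\<in>ob C. fmor F (x, x, idt C x) = idt D (fob F x)) \<and>
     (\<forall>x\<in>ob C. \<forall>y\<in>ob C. \<forall>z\<in>ob C. \<forall>f\<in>hom C x y. \<forall>g\<in>hom C y z.
        fmor F (x, z, cmp C x y z g f) =
          cmp D (fob F x) (fob F y) (fob F z) (fmor F (y, z, g)) (fmor F (x, y, f)))}"

definition id_functor :: "('o, 'm) cat \<Rightarrow> ('o, 'm, 'o, 'm) functor_data" where
  "id_functor C = \<lparr>fob = (\<lambda>x\<in>ob C. x), fmor = (\<lambda>(x, y, f)\<in>arrows C. f)\<rparr>"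

definition comp_functor :: "('o, 'm) cat \<Rightarrow> ('p, 'n, 'q, 'l) functor_data \<Rightarrow> ('o, 'm, 'p, 'n) functor_data
    \<Rightarrow> ('o, 'm, 'q, 'l) functor_data" where
  "comp_functor C G F =
     \<lparr>fob = compose (ob C) (fob G) (fob F),
      fmor = (\<lambda>(x, y, f)\<in>arrows C. fmor G (fob F x, fob F y, fmor F (x, y, f)))\<rparr>"

definition iso_in :: "('o, 'm) cat \<Rightarrow> 'o \<Rightarrow> 'o \<Rightarrow> 'm \<Rightarrow> bool" where
  "iso_in C x y f \<longleftrightarrow> f \<in> hom C x y \<and>
     (\<exists>g\<in>hom C y x. cmp C x y x g f = idt C x \<and> cmp C y x y f g = idt C y)"

definition natural_iso :: "('o, 'm) cat \<Rightarrow> ('p, 'n) cat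
    \<Rightarrow> ('o, 'm, 'p, 'n) functor_data \<Rightarrow> ('o, 'm, 'p, 'n) functor_data \<Rightarrow> ('o \<Rightarrow> 'n) \<Rightarrow> bool" where
  "natural_iso C D F G \<eta> \<longleftrightarrow>
     (\<forall>x\<in>ob C. iso_in D (fob F x) (fob G x) (\<eta> x)) \<and>
     (\<forall>x\<in>ob C. \<forall>y\<in>ob C. \<forall>f\<in>hom C x y.
        cmp D (fob F x) (fob F y) (fob G y) (\<eta> y) (fmor F (x, y, f)) =
        cmp D (fob F x) (fob G x) (fob G y) (fmor G (x, y, f)) (\<eta> x))"

definition equivalence_of_categories ::
  "('o, 'm) cat \<Rightarrow> ('p, 'n) cat \<Rightarrow> ('o, 'm, 'p, 'n) functor_data \<Rightarrow> bool" where
  "equivalence_of_categories C D F \<longleftrightarrow> category C \<and> category D \<and> F \<in> functors C D \<and>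
     (\<exists>G\<in>functors D C.
        (\<exists>\<eta>. natural_iso C C (id_functor C) (comp_functor C G F) \<eta>) \<and>
        (\<exists>\<epsilon>. natural_iso D D (comp_functor D F G) (id_functor D) \<epsilon>))"


section \<open>The nerve and the interval \<open>I\<close>\<close>

definition ordinal_cat :: "nat \<Rightarrow> (nat, unit) cat" where
  "ordinal_cat n = \<lparr>ob = {..n}, hom = (\<lambda>i j. if i \<le> j then {()} else {}),
     idt = (\<lambda>i. ()), cmp = (\<lambda>i j k g f. ())\<rparr>"

definition ordinal_functor :: "nat \<Rightarrow> (nat \<Rightarrow> nat) \<Rightarrow> (nat, unit, nat, unit) functor_data" where
  "ordinal_functor m \<theta> = \<lparr>fob = \<theta>, fmor = (\<lambda>a\<in>arrows (ordinal_cat m). ())\<rparr>"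

definition nerve :: "('o, 'm) cat \<Rightarrow> (nat, unit, 'o, 'm) functor_data sset" where
  "nerve C = \<lparr>simps = (\<lambda>n. functors (ordinal_cat n) C),
     act = (\<lambda>m n \<theta> F. comp_functor (ordinal_cat m) F (ordinal_functor m \<theta>))\<rparr>"

definition iso_groupoid :: "(nat, unit) cat" where
  "iso_groupoid = \<lparr>ob = {0, 1}, hom = (\<lambda>x y. {()}), idt = (\<lambda>x. ()), cmp = (\<lambda>x y z g f. ())\<rparr>"

definition interval :: "(nat, unit, nat, unit) functor_data sset" where
  "interval = nerve iso_groupoid"

text \<open>The unique \<open>n\<close>-simplex of the subcomplex \<open>{a} \<subseteq> I\<close>, for an object \<open>a\<close> of the groupoid.\<close>

definition interval_vertex :: "nat \<Rightarrow> nat \<Rightarrow> (nat, unit, nat, unit) functor_data" where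
  "interval_vertex a n =
     \<lparr>fob = (\<lambda>i\<in>{..n}. a), fmor = (\<lambda>f\<in>arrows (ordinal_cat n). ())\<rparr>"


section \<open>Categorical weak equivalences\<close>

definition I_homotopic ::
  "'a sset \<Rightarrow> 'b sset \<Rightarrow> (nat \<Rightarrow> 'a \<Rightarrow> 'b) \<Rightarrow> (nat \<Rightarrow> 'a \<Rightarrow> 'b) \<Rightarrow> bool" where
  "I_homotopic K Z f g \<longleftrightarrow> f \<in> smaps K Z \<and> g \<in> smaps K Z \<and>
     (\<exists>h\<in>smaps (sprod K interval) Z. \<forall>n. \<forall>x\<in>simps K n.
        h n (x, interval_vertex 0 n) = f n x \<and> h n (x, interval_vertex 1 n) = g n x)"

definition I_homotopy_rel :: "'a sset \<Rightarrow> 'b sset \<Rightarrow> (nat \<Rightarrow> 'a \<Rightarrow> 'b) rel" where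
  "I_homotopy_rel K Z = {(f, g). f \<in> smaps K Z \<and> g \<in> smaps K Z \<and> equivclp (I_homotopic K Z) f g}"

definition pi_I :: "'a sset \<Rightarrow> 'b sset \<Rightarrow> (nat \<Rightarrow> 'a \<Rightarrow> 'b) set set" where
  "pi_I K Z = smaps K Z // I_homotopy_rel K Z"

text \<open>\<open>pi_I_pullback X Z f\<close> is \<open>f\<^sup>* : \<pi>\<^sub>I(Y,Z) \<rightarrow> \<pi>\<^sub>I(X,Z)\<close>, \<open>[u] \<mapsto> [u \<circ> f]\<close>, for \<open>f : X \<rightarrow> Y\<close>.\<close>

definition pi_I_pullback :: "'a sset \<Rightarrow> 'c sset \<Rightarrow> (nat \<Rightarrow> 'a \<Rightarrow> 'b)
    \<Rightarrow> (nat \<Rightarrow> 'b \<Rightarrow> 'c) set \<Rightarrow> (nat \<Rightarrow> 'a \<Rightarrow> 'c) set" where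
  "pi_I_pullback X Z f c = (\<Union>u\<in>c. I_homotopy_rel X Z `` {smap_comp X u f})"

text \<open>
  \<open>Z\<close> ranges over the quasi-categories with simplices in the same infinite type \<open>'u\<close> that carries \<open>X\<close>
  and \<open>Y\<close>. This bound is harmless: every subset of a quasi-category of cardinality at most that of
  \<open>'u\<close> lies in a sub-quasi-category of that cardinality, so bijectivity for these \<open>Z\<close> already
  implies bijectivity for all \<open>Z\<close>. The type has to be infinite for this.
\<close>

definition categorical_weak_equivalence ::
  "'u::infinite sset \<Rightarrow> 'u sset \<Rightarrow> (nat \<Rightarrow> 'u \<Rightarrow> 'u) \<Rightarrow> bool" where
  "categorical_weak_equivalence X Y f \<longleftrightarrow>
     (\<forall>Z :: 'u sset. quasi_category Z \<longrightarrow>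
        bij_betw (pi_I_pullback X Z f) (pi_I Y Z) (pi_I X Z))"


section \<open>The path category\<close>

text \<open>Paths in the graph with edges \<open>e : d\<^sub>1 e \<rightarrow> d\<^sub>0 e\<close>, listed in the order of travel; the
  composite \<open>q \<cdot> p\<close> in the free category is thus \<open>p @ q\<close>.\<close>

fun edge_path :: "'a sset \<Rightarrow> 'a \<Rightarrow> 'a list \<Rightarrow> 'a \<Rightarrow> bool" where
  "edge_path X x [] y \<longleftrightarrow> x \<in> simps X 0 \<and> x = y"
| "edge_path X x (e # es) y \<longleftrightarrow>
     e \<in> simps X 1 \<and> face X 0 1 e = x \<and> edge_path X (face X 0 0 e) es y"

text \<open>The congruence on the free category generated by \<open>d\<^sub>1 \<sigma> = d\<^sub>0 \<sigma> \<cdot> d\<^sub>2 \<sigma>\<close> and \<open>s\<^sub>0 x = 1\<^sub>x\<close>.\<close>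

inductive path_rel :: "'a sset \<Rightarrow> 'a \<Rightarrow> 'a \<Rightarrow> 'a list \<Rightarrow> 'a list \<Rightarrow> bool" for X where
  refl: "edge_path X x p y \<Longrightarrow> path_rel X x y p p"
| sym: "path_rel X x y p q \<Longrightarrow> path_rel X x y q p"
| trans: "path_rel X x y p q \<Longrightarrow> path_rel X x y q r \<Longrightarrow> path_rel X x y p r"
| cong: "path_rel X x y p p' \<Longrightarrow> path_rel X y z q q' \<Longrightarrow> path_rel X x z (p @ q) (p' @ q')"
| triangle: "\<sigma> \<in> simps X 2 \<Longrightarrow>
    path_rel X (face X 0 1 (face X 1 1 \<sigma>)) (face X 0 0 (face X 1 1 \<sigma>))
      [face X 1 1 \<sigma>] [face X 1 2 \<sigma>, face X 1 0 \<sigma>]"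
| degenerate: "x \<in> simps X 0 \<Longrightarrow> path_rel X x x [degeneracy X 0 0 x] []"

definition path_class :: "'a sset \<Rightarrow> 'a \<Rightarrow> 'a \<Rightarrow> 'a list \<Rightarrow> 'a list set" where
  "path_class X x y p = {q. path_rel X x y p q}"

definition path_category :: "'a sset \<Rightarrow> ('a, 'a list set) cat" where
  "path_category X =
     \<lparr>ob = simps X 0,
      hom = (\<lambda>x y. {path_class X x y p |p. edge_path X x p y}),
      idt = (\<lambda>x. path_class X x x []),
      cmp = (\<lambda>x y z G F. \<Union>p\<in>F. \<Union>q\<in>G. path_class X x z (p @ q))\<rparr>"

definition path_functor :: "'a sset \<Rightarrow> 'b sset \<Rightarrow> (nat \<Rightarrow> 'a \<Rightarrow> 'b)
    \<Rightarrow> ('a, 'a list set, 'b, 'b list set) functor_data" where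
  "path_functor X Y g =
     \<lparr>fob = (\<lambda>x\<in>simps X 0. g 0 x),
      fmor = (\<lambda>(x, y, F)\<in>arrows (path_category X).
                \<Union>p\<in>F. path_class Y (g 0 x) (g 0 y) (map (g 1) p))\<rparr>"

end

theory Submission
  imports Defs
begin

text \<open>
  Nerves of categories are quasi-categories (\<open>quasi_category_nerve\<close>), so a categorical weak
  equivalence \<open>g : X \<rightarrow> Y\<close> induces bijections on homotopy classes of maps into them. A map from \<open>X\<close>
  to the nerve \<open>NC\<close> is the same as a functor \<open>PX \<rightarrow> C\<close>, and a homotopy \<open>X \<times> I \<rightarrow> NC\<close> gives a natural
  isomorphism of functors (\<open>edgewise_iso_homotopic\<close>), since \<open>I\<close> is the nerve of the free
  isomorphism. Homotopy classes of maps \<open>X \<rightarrow> NC\<close> thus stand for isomorphism classes of functors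
  \<open>PX \<rightarrow> C\<close>, and a Yoneda argument makes \<open>g\<^sub>* : PX \<rightarrow> PY\<close> an equivalence.

  Concretely, surjectivity for \<open>C = PX\<close>, applied to the unit \<open>\<eta>\<^sub>X : X \<rightarrow> N(PX)\<close>, gives \<open>u : Y \<rightarrow> N(PX)\<close>
  with \<open>u g \<simeq> \<eta>\<^sub>X\<close>. The functor \<open>G : PY \<rightarrow> PX\<close> corresponding to \<open>u\<close> then satisfies \<open>G g\<^sub>* \<cong> 1\<close>. Moreover
  \<open>N(g\<^sub>*) u g \<simeq> N(g\<^sub>*) \<eta>\<^sub>X = \<eta>\<^sub>Y g\<close> by naturality of the unit (\<open>path_unit_natural\<close>), so injectivity for
  \<open>C = PY\<close> yields \<open>N(g\<^sub>*) u \<simeq> \<eta>\<^sub>Y\<close>, that is \<open>g\<^sub>* G \<cong> 1\<close>.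

  Weak equivalences are tested on quasi-categories whose simplices lie in the type \<open>'u\<close> of the
  simplices of \<open>X\<close> and \<open>Y\<close>. The simplices of \<open>N(PX)\<close> are finite diagrams of classes of finite paths,
  hence can be coded injectively in the infinite type \<open>'u\<close> (\<open>nerve_path_category_embeddable\<close>); the
  bijectivity is transported along this coding (\<open>restriction_bijective_if_embeddable\<close>).
\<close>

section \<open>Categories and functors\<close>

lemma id_in_hom: "category C \<Longrightarrow> x \<in> ob C \<Longrightarrow> idt C x \<in> hom C x x"
  unfolding category_def by blast

lemma cmp_in_hom:
  "category C \<Longrightarrow> x \<in> ob C \<Longrightarrow> y \<in> ob C \<Longrightarrow> z \<in> ob C \<Longrightarrow> f \<in> hom C x y \<Longrightarrow> g \<in> hom C y z
    \<Longrightarrow> cmp C x y z g f \<in> hom C x z"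
  unfolding category_def by blast

lemma cmp_id_right:
  "category C \<Longrightarrow> x \<in> ob C \<Longrightarrow> y \<in> ob C \<Longrightarrow> f \<in> hom C x y \<Longrightarrow> cmp C x x y f (idt C x) = f"
  unfolding category_def by blast

lemma cmp_id_left:
  "category C \<Longrightarrow> x \<in> ob C \<Longrightarrow> y \<in> ob C \<Longrightarrow> f \<in> hom C x y \<Longrightarrow> cmp C x y y (idt C y) f = f"
  unfolding category_def by blast

lemma cmp_assoc:
  "category C \<Longrightarrow> w \<in> ob C \<Longrightarrow> x \<in> ob C \<Longrightarrow> y \<in> ob C \<Longrightarrow> z \<in> ob C \<Longrightarrow>
    f \<in> hom C w x \<Longrightarrow> g \<in> hom C x y \<Longrightarrow> h \<in> hom C y z \<Longrightarrow>
    cmp C w x z (cmp C x y z h g) f = cmp C w y z h (cmp C w x y g f)"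
  unfolding category_def by blast

lemma arrows_iff [simp]: "(x, y, f) \<in> arrows C \<longleftrightarrow> x \<in> ob C \<and> y \<in> ob C \<and> f \<in> hom C x y"
  by (simp add: arrows_def)

lemma functor_ob: "F \<in> functors C D \<Longrightarrow> x \<in> ob C \<Longrightarrow> fob F x \<in> ob D"
  unfolding functors_def by auto

lemma functor_hom:
  "F \<in> functors C D \<Longrightarrow> x \<in> ob C \<Longrightarrow> y \<in> ob C \<Longrightarrow> f \<in> hom C x y \<Longrightarrow>
    fmor F (x, y, f) \<in> hom D (fob F x) (fob F y)"
  unfolding functors_def PiE_def Pi_def arrows_def by blast

lemma functor_id: "F \<in> functors C D \<Longrightarrow> x \<in> ob C \<Longrightarrow> fmor F (x, x, idt C x) = idt D (fob F x)"
  unfolding functors_def by blast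

lemma functor_cmp:
  "F \<in> functors C D \<Longrightarrow> x \<in> ob C \<Longrightarrow> y \<in> ob C \<Longrightarrow> z \<in> ob C \<Longrightarrow> f \<in> hom C x y \<Longrightarrow> g \<in> hom C y z \<Longrightarrow>
    fmor F (x, z, cmp C x y z g f) =
      cmp D (fob F x) (fob F y) (fob F z) (fmor F (y, z, g)) (fmor F (x, y, f))"
  unfolding functors_def by blast

lemma functorsI:
  assumes "fob F \<in> extensional (ob C)" "fmor F \<in> extensional (arrows C)"
    and "\<And>x. x \<in> ob C \<Longrightarrow> fob F x \<in> ob D"
    and "\<And>x y f. x \<in> ob C \<Longrightarrow> y \<in> ob C \<Longrightarrow> f \<in> hom C x y \<Longrightarrow>
      fmor F (x, y, f) \<in> hom D (fob F x) (fob F y)"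
    and "\<And>x. x \<in> ob C \<Longrightarrow> fmor F (x, x, idt C x) = idt D (fob F x)"
    and "\<And>x y z f g. x \<in> ob C \<Longrightarrow> y \<in> ob C \<Longrightarrow> z \<in> ob C \<Longrightarrow> f \<in> hom C x y \<Longrightarrow> g \<in> hom C y z \<Longrightarrow>
      fmor F (x, z, cmp C x y z g f) =
        cmp D (fob F x) (fob F y) (fob F z) (fmor F (y, z, g)) (fmor F (x, y, f))"
  shows "F \<in> functors C D"
  unfolding functors_def PiE_def Pi_def using assms by auto

lemma id_functor_in: "category C \<Longrightarrow> id_functor C \<in> functors C C"
  by (rule functorsI) (auto simp: id_functor_def id_in_hom cmp_in_hom)

lemma comp_functor_in:
  assumes "category C" "F \<in> functors C D" "G \<in> functors D E"
  shows "comp_functor C G F \<in> functors C E"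
  using assms
  by (intro functorsI)
    (auto simp: comp_functor_def compose_def functor_ob functor_hom functor_id functor_cmp
      id_in_hom cmp_in_hom)

text \<open>The inverse of an isomorphism between parallel functors turns its naturality squares around.\<close>

lemma iso_square_inverse:
  assumes C: "category C" and ob: "a \<in> ob C" "a' \<in> ob C" "b \<in> ob C" "b' \<in> ob C"
    and f: "f \<in> hom C a a'" and g: "g \<in> hom C b b'"
    and s: "s \<in> hom C a b" and r: "r \<in> hom C b a" and sr: "cmp C b a b s r = idt C b"
    and s': "s' \<in> hom C a' b'" and r': "r' \<in> hom C b' a'" and rs': "cmp C a' b' a' r' s' = idt C a'"
    and sq: "cmp C a a' b' s' f = cmp C a b b' g s"
  shows "cmp C b b' a' r' g = cmp C b a a' f r"
proof -
  have "cmp C b b' a' r' g = cmp C b b' a' r' (cmp C b b b' g (cmp C b a b s r))"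
    using C ob g by (simp add: sr cmp_id_right)
  also have "\<dots> = cmp C b b' a' r' (cmp C b a b' (cmp C a b b' g s) r)"
    using C ob g s r by (simp add: cmp_assoc)
  also have "\<dots> = cmp C b b' a' r' (cmp C b a b' (cmp C a a' b' s' f) r)"
    by (simp add: sq)
  also have "\<dots> = cmp C b a a' (cmp C a a' a' (cmp C a' b' a' r' s') f) r"
    using C ob f s' r r' by (simp add: cmp_assoc cmp_in_hom)
  also have "\<dots> = cmp C b a a' f r"
    using C ob f by (simp add: rs' cmp_id_left)
  finally show ?thesis .
qed

text \<open>
  Pasting is used in both directions: along a composite of arrows, to extend naturality from edges
  to paths, and along a composite of natural transformations.
\<close>

lemma iso_square_paste:
  assumes C: "category C"
    and ob: "a \<in> ob C" "a' \<in> ob C" "b \<in> ob C" "b' \<in> ob C" "c \<in> ob C" "c' \<in> ob C"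
    and "f \<in> hom C a a'" "g \<in> hom C b b'" "h \<in> hom C c c'"
    and "s \<in> hom C a b" "s' \<in> hom C a' b'" "t \<in> hom C b c" "t' \<in> hom C b' c'"
    and sq1: "cmp C a a' b' s' f = cmp C a b b' g s"
    and sq2: "cmp C b b' c' t' g = cmp C b c c' h t"
  shows "cmp C a a' c' (cmp C a' b' c' t' s') f = cmp C a c c' h (cmp C a b c t s)"
proof -
  have "cmp C a a' c' (cmp C a' b' c' t' s') f = cmp C a b' c' t' (cmp C a a' b' s' f)"
    using assms(1-14) by (simp add: cmp_assoc)
  also have "\<dots> = cmp C a b' c' t' (cmp C a b b' g s)"
    by (simp only: sq1)
  also have "\<dots> = cmp C a b c' (cmp C b b' c' t' g) s"
    using assms(1-14) by (simp add: cmp_assoc)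
  also have "\<dots> = cmp C a b c' (cmp C b c c' h t) s"
    by (simp only: sq2)
  also have "\<dots> = cmp C a c c' h (cmp C a b c t s)"
    using assms(1-14) by (simp add: cmp_assoc)
  finally show ?thesis .
qed

lemma iso_in_id: "category C \<Longrightarrow> x \<in> ob C \<Longrightarrow> iso_in C x x (idt C x)"
  unfolding iso_in_def using id_in_hom[of C x] cmp_id_left[of C x x "idt C x"] by auto

lemma iso_in_cmp:
  assumes C: "category C" and ob: "x \<in> ob C" "y \<in> ob C" "z \<in> ob C"
    and f: "iso_in C x y f" and g: "iso_in C y z g"
  shows "iso_in C x z (cmp C x y z g f)"
proof -
  obtain f' where f': "f \<in> hom C x y" "f' \<in> hom C y x"
    "cmp C x y x f' f = idt C x" "cmp C y x y f f' = idt C y"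
    using f unfolding iso_in_def by blast
  obtain g' where g': "g \<in> hom C y z" "g' \<in> hom C z y"
    "cmp C y z y g' g = idt C y" "cmp C z y z g g' = idt C z"
    using g unfolding iso_in_def by blast
  let ?h = "cmp C z y x f' g'"
  have "cmp C x z x ?h (cmp C x y z g f) = cmp C x y x f' (cmp C x y y (cmp C y z y g' g) f)"
    using C ob f'(1,2) g'(1,2) by (simp add: cmp_assoc cmp_in_hom)
  then have 1: "cmp C x z x ?h (cmp C x y z g f) = idt C x"
    using C ob f' by (simp add: g' cmp_id_left)
  have "cmp C z x z (cmp C x y z g f) ?h = cmp C z y z g (cmp C z y y (cmp C y x y f f') g')"
    using C ob f'(1,2) g'(1,2) by (simp add: cmp_assoc cmp_in_hom)
  then have 2: "cmp C z x z (cmp C x y z g f) ?h = idt C z"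
    using C ob g' by (simp add: f' cmp_id_left)
  show ?thesis
    unfolding iso_in_def using 1 2 C ob f'(1,2) g'(1,2) by (auto simp: cmp_in_hom)
qed


section \<open>Simplices spanned by lists of vertices\<close>

text \<open>
  An operator \<open>[m] \<rightarrow> [n]\<close> is written as the list of its \<open>m + 1\<close> values. The simplex of \<open>X\<close> obtained
  from \<open>x \<in> X\<^sub>n\<close> by the operator is \<open>subsimplex X n xs x\<close>; faces and degeneracies in low dimensions
  then become explicit lists, and the simplicial identities are computed by mapping over lists.
\<close>

definition list_op :: "nat list \<Rightarrow> nat \<Rightarrow> nat" where
  "list_op xs = (\<lambda>a\<in>{..length xs - 1}. xs ! a)"

definition subsimplex :: "'a sset \<Rightarrow> nat \<Rightarrow> nat list \<Rightarrow> 'a \<Rightarrow> 'a" where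
  "subsimplex X n xs x = act X (length xs - 1) n (list_op xs) x"

lemma list_op_in_simp_op:
  assumes "length xs = Suc m" "sorted xs" "set xs \<subseteq> {..n}"
  shows "list_op xs \<in> simp_op m n"
proof -
  have "xs ! a \<le> n" if "a \<le> m" for a
    using assms(1,3) that by (metis atMost_iff le_imp_less_Suc nth_mem subsetD)
  moreover have "xs ! a \<le> xs ! b" if "a \<le> b" "b \<le> m" for a b
    using assms(1,2) that by (simp add: sorted_nth_mono)
  ultimately show ?thesis
    using assms(1) by (auto simp: simp_op_def list_op_def mono_on_def)
qed

lemma compose_list_op:
  assumes "xs \<noteq> []"
  shows "compose {..length xs - 1} \<theta> (list_op xs) = list_op (map \<theta> xs)"
proof -
  have "a < length xs" if "a \<le> length xs - 1" for a
    using assms that by (cases xs) auto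
  then show ?thesis
    by (auto simp: compose_def list_op_def fun_eq_iff)
qed

lemma list_op_image: "xs \<noteq> [] \<Longrightarrow> list_op xs ` {..length xs - 1} = set xs"
  unfolding list_op_def by (cases xs) (auto simp: set_conv_nth less_Suc_eq_le image_iff Bex_def)

lemma simplicial_set_act:
  "simplicial_set X \<Longrightarrow> \<theta> \<in> simp_op m n \<Longrightarrow> x \<in> simps X n \<Longrightarrow> act X m n \<theta> x \<in> simps X m"
  unfolding simplicial_set_def by blast

lemma simplicial_set_comp:
  "simplicial_set X \<Longrightarrow> \<tau> \<in> simp_op k m \<Longrightarrow> \<theta> \<in> simp_op m n \<Longrightarrow> x \<in> simps X n \<Longrightarrow>
    act X k m \<tau> (act X m n \<theta> x) = act X k n (compose {..k} \<theta> \<tau>) x"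
  unfolding simplicial_set_def by force

lemma subsimplex_in:
  assumes "simplicial_set X" "x \<in> simps X n" "length xs = Suc m" "sorted xs" "set xs \<subseteq> {..n}"
  shows "subsimplex X n xs x \<in> simps X m"
  using simplicial_set_act[OF assms(1) list_op_in_simp_op[OF assms(3-5)] assms(2)] assms(3)
  by (simp add: subsimplex_def)

lemma subsimplex_act:
  assumes X: "simplicial_set X" and x: "x \<in> simps X n" and t: "\<theta> \<in> simp_op m n"
    and xs: "xs \<noteq> []" "sorted xs" "set xs \<subseteq> {..m}"
  shows "subsimplex X m xs (act X m n \<theta> x) = subsimplex X n (map \<theta> xs) x"
proof -
  have "list_op xs \<in> simp_op (length xs - 1) m"
    using xs by (intro list_op_in_simp_op) (auto simp: Suc_pred')
  then show ?thesis
    unfolding subsimplex_def using simplicial_set_comp[OF X _ t x] compose_list_op[OF xs(1)]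
    by simp
qed

lemma subsimplex_subsimplex:
  assumes X: "simplicial_set X" and x: "x \<in> simps X n"
    and xs: "length xs = Suc m" "sorted xs" "set xs \<subseteq> {..n}"
    and ys: "ys \<noteq> []" "sorted ys" "set ys \<subseteq> {..m}"
  shows "subsimplex X m ys (subsimplex X n xs x) = subsimplex X n (map ((!) xs) ys) x"
proof -
  have eq: "map (list_op xs) ys = map ((!) xs) ys"
    using xs(1) ys(3) by (auto simp: list_op_def)
  then show ?thesis
    using subsimplex_act[OF X x list_op_in_simp_op[OF xs] ys] xs(1) unfolding eq
    by (simp add: subsimplex_def)
qed

lemma smap_in: "f \<in> smaps X Y \<Longrightarrow> x \<in> simps X n \<Longrightarrow> f n x \<in> simps Y n"
  unfolding smaps_def by blast

lemma smap_act:
  "f \<in> smaps X Y \<Longrightarrow> \<theta> \<in> simp_op m n \<Longrightarrow> x \<in> simps X n \<Longrightarrow> f m (act X m n \<theta> x) = act Y m n \<theta> (f n x)"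
  unfolding smaps_def by blast

lemma smap_ext: "f \<in> smaps X Y \<Longrightarrow> x \<notin> simps X n \<Longrightarrow> f n x = undefined"
  unfolding smaps_def PiE_def extensional_def by blast

lemma smap_eqI:
  assumes "f \<in> smaps X Y" "g \<in> smaps X Z" "\<And>n x. x \<in> simps X n \<Longrightarrow> f n x = g n x"
  shows "f = g"
proof (intro ext)
  show "f n x = g n x" for n x
    using assms by (cases "x \<in> simps X n") (simp_all add: smap_ext)
qed

lemma smapsI:
  assumes "\<And>n. f n \<in> extensional (simps X n)" "\<And>n x. x \<in> simps X n \<Longrightarrow> f n x \<in> simps Y n"
    and "\<And>m n \<theta> x. \<theta> \<in> simp_op m n \<Longrightarrow> x \<in> simps X n \<Longrightarrow> f m (act X m n \<theta> x) = act Y m n \<theta> (f n x)"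
  shows "f \<in> smaps X Y"
  unfolding smaps_def PiE_def Pi_def using assms by blast

lemma smap_subsimplex:
  assumes "f \<in> smaps X Y" "x \<in> simps X n" "length xs = Suc m" "sorted xs" "set xs \<subseteq> {..n}"
  shows "f m (subsimplex X n xs x) = subsimplex Y n xs (f n x)"
  using smap_act[OF assms(1) list_op_in_simp_op[OF assms(3-5)] assms(2)] assms(3)
  by (simp add: subsimplex_def)

lemma smap_comp_apply: "x \<in> simps X n \<Longrightarrow> smap_comp X g f n x = g n (f n x)"
  by (simp add: smap_comp_def compose_def)

lemma smap_comp_in:
  assumes "simplicial_set X" "f \<in> smaps X Y" "g \<in> smaps Y Z"
  shows "smap_comp X g f \<in> smaps X Z"
  using assms
  by (intro smapsI)
    (auto simp: smap_comp_apply smap_in smap_act simplicial_set_act smap_comp_def compose_def)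

lemma smap_comp_assoc:
  assumes "f \<in> smaps X Y"
  shows "smap_comp X h (smap_comp X g f) = smap_comp X (smap_comp Y h g) f"
  using assms by (auto simp: smap_comp_def compose_def fun_eq_iff smap_in)

lemma face_edge:
  "face X 0 0 = subsimplex X 1 [1]" "face X 0 (Suc 0) = subsimplex X 1 [0]"
  unfolding face_def subsimplex_def
  by (auto simp: list_op_def coface_def fun_eq_iff intro!: arg_cong[where f = "\<lambda>t. act X _ _ t _"])

lemma face_triangle:
  "face X (Suc 0) 0 = subsimplex X 2 [1, 2]" "face X (Suc 0) (Suc 0) = subsimplex X 2 [0, 2]"
  "face X (Suc 0) 2 = subsimplex X 2 [0, 1]"
  unfolding face_def subsimplex_def
  by (auto simp: list_op_def coface_def fun_eq_iff less_Suc_eq_le le_Suc_eq numeral_2_eq_2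
      intro!: arg_cong[where f = "\<lambda>t. act X _ _ t _"])

lemma degeneracy_vertex: "degeneracy X 0 0 = subsimplex X 0 [0, 0]"
  unfolding degeneracy_def subsimplex_def
  by (auto simp: list_op_def codegeneracy_def fun_eq_iff le_Suc_eq
      intro!: arg_cong[where f = "\<lambda>t. act X _ _ t _"])


section \<open>The path category\<close>

abbreviation src :: "'a sset \<Rightarrow> 'a \<Rightarrow> 'a" where "src X \<equiv> subsimplex X 1 [0]"
abbreviation tgt :: "'a sset \<Rightarrow> 'a \<Rightarrow> 'a" where "tgt X \<equiv> subsimplex X 1 [1]"

lemma edge_path_Cons:
  "edge_path X x (e # es) y \<longleftrightarrow> e \<in> simps X 1 \<and> src X e = x \<and> edge_path X (tgt X e) es y"
  by (simp add: face_edge)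

declare edge_path.simps(2) [simp del]

lemma edge_path_ends:
  "simplicial_set X \<Longrightarrow> edge_path X x p y \<Longrightarrow> x \<in> simps X 0 \<and> y \<in> simps X 0"
  by (induction p arbitrary: x) (auto simp: edge_path_Cons subsimplex_in)

lemma edge_path_append:
  "edge_path X x p y \<Longrightarrow> edge_path X y q z \<Longrightarrow> edge_path X x (p @ q) z"
  by (induction p arbitrary: x) (auto simp: edge_path_Cons)

lemma edge_path_edge:
  "simplicial_set X \<Longrightarrow> e \<in> simps X 1 \<Longrightarrow> edge_path X (src X e) [e] (tgt X e)"
  by (simp add: edge_path_Cons subsimplex_in)

lemma edge_path_edge_of_simplex:
  assumes "simplicial_set X" "x \<in> simps X n" "i \<le> j" "j \<le> n"
  shows "edge_path X (subsimplex X n [i] x) [subsimplex X n [i, j] x] (subsimplex X n [j] x)"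
  using assms by (simp add: edge_path_Cons subsimplex_in subsimplex_subsimplex)

lemma path_rel_triangle:
  assumes X: "simplicial_set X" and s: "\<sigma> \<in> simps X 2"
  shows "path_rel X (subsimplex X 2 [0] \<sigma>) (subsimplex X 2 [2] \<sigma>) [subsimplex X 2 [0, 2] \<sigma>]
    [subsimplex X 2 [0, 1] \<sigma>, subsimplex X 2 [1, 2] \<sigma>]"
  using path_rel.triangle[OF s] X s
  by (simp add: face_edge face_triangle subsimplex_subsimplex)

lemma path_rel_degenerate:
  "x \<in> simps X 0 \<Longrightarrow> path_rel X x x [subsimplex X 0 [0, 0] x] []"
  using path_rel.degenerate[of x X] by (simp add: degeneracy_vertex)

lemma subsimplex_vertex:
  assumes "simplicial_set X" "x \<in> simps X 0"
  shows "subsimplex X 0 [0] x = x"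
proof -
  have "list_op [0] = (\<lambda>i\<in>{..0}. i)"
    by (auto simp: list_op_def fun_eq_iff)
  moreover have "act X 0 0 (\<lambda>i\<in>{..0}. i) x = x"
    using assms unfolding simplicial_set_def by blast
  ultimately show ?thesis
    by (simp add: subsimplex_def)
qed

lemma path_rel_edge_path:
  assumes X: "simplicial_set X" and "path_rel X x y p q"
  shows "edge_path X x p y \<and> edge_path X x q y"
  using assms(2)
proof induction
  case (cong x y p p' z q q')
  then show ?case by (blast intro: edge_path_append)
next
  case (triangle \<sigma>)
  then show ?case
    using X by (simp add: face_edge face_triangle subsimplex_subsimplex subsimplex_in edge_path_Cons)
next
  case (degenerate x)
  then show ?case
    using X by (simp add: degeneracy_vertex subsimplex_subsimplex subsimplex_in edge_path_Cons
        subsimplex_vertex)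
qed auto

lemma path_class_eqI: "path_rel X x y p q \<Longrightarrow> path_class X x y p = path_class X x y q"
  unfolding path_class_def by (blast intro: path_rel.sym path_rel.trans)

lemma path_class_self: "edge_path X x p y \<Longrightarrow> p \<in> path_class X x y p"
  by (simp add: path_class_def path_rel.refl)

lemma path_class_memD:
  assumes "simplicial_set X" "q \<in> path_class X x y p"
  shows "edge_path X x q y" "path_class X x y q = path_class X x y p"
  using assms path_rel_edge_path[of X x y p q] path_class_eqI[of X x y p q]
  by (auto simp: path_class_def[of _ _ _ p])

lemma path_category_simps [simp]:
  "ob (path_category X) = simps X 0"
  "hom (path_category X) x y = {path_class X x y p |p. edge_path X x p y}"
  "idt (path_category X) x = path_class X x x []"
  by (simp_all add: path_category_def)

text \<open>Members of the same hom-set are equivalence classes, so one path determines its class.\<close>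

lemma path_hom_eqI:
  assumes "simplicial_set X" "A \<in> hom (path_category X) x y" "B \<in> hom (path_category X) x y"
    and "p \<in> A" "p \<in> B"
  shows "A = B"
proof -
  obtain q r where qr: "A = path_class X x y q" "B = path_class X x y r"
    using assms(2,3) by auto
  then show ?thesis
    using path_class_memD(2)[OF assms(1), of p x y q] path_class_memD(2)[OF assms(1), of p x y r]
      assms(4,5) by simp
qed

lemma cmp_path_class:
  assumes X: "simplicial_set X" and p: "edge_path X x p y" and q: "edge_path X y q z"
  shows "cmp (path_category X) x y z (path_class X y z q) (path_class X x y p) =
    path_class X x z (p @ q)"
proof -
  have "path_class X x z (p' @ q') = path_class X x z (p @ q)"
    if "p' \<in> path_class X x y p" "q' \<in> path_class X y z q" for p' q'
    using that path_rel.cong[of X x y p p' z q q', THEN path_class_eqI] by (simp add: path_class_def)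
  then have "cmp (path_category X) x y z (path_class X y z q) (path_class X x y p) =
      (\<Union>p'\<in>path_class X x y p. \<Union>q'\<in>path_class X y z q. path_class X x z (p @ q))"
    by (simp add: path_category_def)
  then show ?thesis
    using path_class_self[OF p] path_class_self[OF q] by blast
qed

lemma category_path_category:
  assumes X: "simplicial_set X"
  shows "category (path_category X)"
proof -
  have comp: "\<exists>r. path_class X x z (p @ q) = path_class X x z r \<and> edge_path X x r z"
    if "edge_path X x p y" "edge_path X y q z" for x y z p q
    using edge_path_append[OF that] by blast
  have unit: "edge_path X x [] x" if "x \<in> simps X 0" for x
    using that by simp
  show ?thesis
    unfolding category_def
    by (auto simp: cmp_path_class[OF X] unit edge_path_append comp)
qed

lemma functors_path_categoryI:
  assumes X: "simplicial_set X"
    and "fob F \<in> extensional (simps X 0)" "fmor F \<in> extensional (arrows (path_category X))"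
    and "\<And>x. x \<in> simps X 0 \<Longrightarrow> fob F x \<in> ob D"
    and "\<And>x y p. edge_path X x p y \<Longrightarrow>
      fmor F (x, y, path_class X x y p) \<in> hom D (fob F x) (fob F y)"
    and "\<And>x. x \<in> simps X 0 \<Longrightarrow> fmor F (x, x, path_class X x x []) = idt D (fob F x)"
    and "\<And>x y z p q. edge_path X x p y \<Longrightarrow> edge_path X y q z \<Longrightarrow>
      fmor F (x, z, path_class X x z (p @ q)) =
        cmp D (fob F x) (fob F y) (fob F z)
          (fmor F (y, z, path_class X y z q)) (fmor F (x, y, path_class X x y p))"
  shows "F \<in> functors (path_category X) D"
  by (rule functorsI) (use assms in \<open>auto simp: cmp_path_class\<close>)

subsection \<open>The universal property\<close>

text \<open>
  The data defining a functor from the path category to \<open>C\<close>: the generators are sent to objects and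
  morphisms of \<open>C\<close> so that the two defining relations hold.
\<close>

definition path_diagram ::
  "'a sset \<Rightarrow> ('o, 'm) cat \<Rightarrow> ('a \<Rightarrow> 'o) \<Rightarrow> ('a \<Rightarrow> 'm) \<Rightarrow> bool" where
  "path_diagram X C V M \<longleftrightarrow>
     (\<forall>x\<in>simps X 0. V x \<in> ob C) \<and>
     (\<forall>e\<in>simps X 1. M e \<in> hom C (V (src X e)) (V (tgt X e))) \<and>
     (\<forall>x\<in>simps X 0. M (subsimplex X 0 [0, 0] x) = idt C (V x)) \<and>
     (\<forall>\<sigma>\<in>simps X 2. M (subsimplex X 2 [0, 2] \<sigma>) =
        cmp C (V (subsimplex X 2 [0] \<sigma>)) (V (subsimplex X 2 [1] \<sigma>)) (V (subsimplex X 2 [2] \<sigma>))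
          (M (subsimplex X 2 [1, 2] \<sigma>)) (M (subsimplex X 2 [0, 1] \<sigma>)))"

fun path_value ::
  "'a sset \<Rightarrow> ('o, 'm) cat \<Rightarrow> ('a \<Rightarrow> 'o) \<Rightarrow> ('a \<Rightarrow> 'm) \<Rightarrow> 'a \<Rightarrow> 'a list \<Rightarrow> 'a \<Rightarrow> 'm" where
  "path_value X C V M x [] y = idt C (V x)"
| "path_value X C V M x (e # es) y =
     cmp C (V x) (V (tgt X e)) (V y) (path_value X C V M (tgt X e) es y) (M e)"

definition path_extension ::
  "'a sset \<Rightarrow> ('o, 'm) cat \<Rightarrow> ('a \<Rightarrow> 'o) \<Rightarrow> ('a \<Rightarrow> 'm) \<Rightarrow> ('a, 'a list set, 'o, 'm) functor_data" where
  "path_extension X C V M =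
     \<lparr>fob = (\<lambda>x\<in>simps X 0. V x),
      fmor = (\<lambda>(x, y, A)\<in>arrows (path_category X). path_value X C V M x (SOME p. p \<in> A) y)\<rparr>"

context
  fixes X :: "'a sset" and C :: "('o, 'm) cat" and V :: "'a \<Rightarrow> 'o" and M :: "'a \<Rightarrow> 'm"
  assumes X: "simplicial_set X" and C: "category C" and VM: "path_diagram X C V M"
begin

lemma diagram_ob: "x \<in> simps X 0 \<Longrightarrow> V x \<in> ob C"
  using VM unfolding path_diagram_def by blast

lemma diagram_hom: "e \<in> simps X 1 \<Longrightarrow> M e \<in> hom C (V (src X e)) (V (tgt X e))"
  using VM unfolding path_diagram_def by blast

lemma path_value_hom:
  "edge_path X x p y \<Longrightarrow> path_value X C V M x p y \<in> hom C (V x) (V y)"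
proof (induction p arbitrary: x)
  case Nil
  then show ?case by (auto intro: diagram_ob id_in_hom[OF C])
next
  case (Cons e p)
  then have "e \<in> simps X 1" "x = src X e" "edge_path X (tgt X e) p y"
    by (auto simp: edge_path_Cons)
  then show ?case
    using Cons.IH diagram_hom[of e] edge_path_ends[OF X Cons.prems] subsimplex_in[OF X, of e 1 "[1]" 0]
    by (auto intro!: cmp_in_hom[OF C] diagram_ob)
qed

lemma path_value_edge: "e \<in> simps X 1 \<Longrightarrow> path_value X C V M (src X e) [e] (tgt X e) = M e"
  using diagram_hom[of e] subsimplex_in[OF X, of e 1] cmp_id_left[OF C]
  by (simp add: diagram_ob)

lemma path_value_append:
  "edge_path X x p y \<Longrightarrow> edge_path X y q z \<Longrightarrow> path_value X C V M x (p @ q) z =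
    cmp C (V x) (V y) (V z) (path_value X C V M y q z) (path_value X C V M x p y)"
proof (induction p arbitrary: x)
  case Nil
  then show ?case
    using path_value_hom[OF Nil(2)] edge_path_ends[OF X Nil(2)]
    by (simp add: cmp_id_right[OF C] diagram_ob)
next
  case (Cons e p)
  then have e: "e \<in> simps X 1" "x = src X e" "edge_path X (tgt X e) p y"
    by (auto simp: edge_path_Cons)
  have "V x \<in> ob C" "V (tgt X e) \<in> ob C" "V y \<in> ob C" "V z \<in> ob C"
    using e edge_path_ends[OF X] Cons.prems by (blast intro: diagram_ob)+
  then show ?case
    using Cons.IH[OF e(3) Cons.prems(2)] cmp_assoc[OF C] diagram_hom[OF e(1)] e(2)
      path_value_hom[OF e(3)] path_value_hom[OF Cons.prems(2)] by simp
qed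

text \<open>The relations of a diagram are what makes the value of a path depend on its class only.\<close>

lemma path_value_cong:
  "path_rel X x y p q \<Longrightarrow> path_value X C V M x p y = path_value X C V M x q y"
proof (induction rule: path_rel.induct)
  case (cong x y p p' z q q')
  then show ?case
    using path_rel_edge_path[OF X cong(1)] path_rel_edge_path[OF X cong(2)]
      path_value_append[of x p y q z] path_value_append[of x p' y q' z] by simp
next
  case (triangle \<sigma>)
  let ?v = "\<lambda>xs. subsimplex X 2 xs \<sigma>"
  have ob: "V (?v [0]) \<in> ob C" "V (?v [1]) \<in> ob C" "V (?v [2]) \<in> ob C"
    using subsimplex_in[OF X triangle] by (simp_all add: diagram_ob)
  have "?v [0, 2] \<in> simps X 1" "?v [0, 1] \<in> simps X 1" "?v [1, 2] \<in> simps X 1"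
    using subsimplex_in[OF X triangle] by simp_all
  note hom = this[THEN diagram_hom]
  have "M (?v [0, 2]) = cmp C (V (?v [0])) (V (?v [1])) (V (?v [2])) (M (?v [1, 2])) (M (?v [0, 1]))"
    using VM triangle unfolding path_diagram_def by blast
  then show ?case
    using ob hom X triangle cmp_id_left[OF C]
    by (simp add: face_edge face_triangle subsimplex_subsimplex)
next
  case (degenerate x)
  then have "M (subsimplex X 0 [0, 0] x) = idt C (V x)" "V x \<in> ob C"
    using VM unfolding path_diagram_def by auto
  then show ?case
    using X degenerate cmp_id_left[OF C] id_in_hom[OF C]
    by (simp add: degeneracy_vertex subsimplex_subsimplex subsimplex_vertex)
qed auto

lemma path_extension_class:
  assumes "edge_path X x p y"
  shows "fmor (path_extension X C V M) (x, y, path_class X x y p) = path_value X C V M x p y"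
proof -
  have "path_rel X x y p (SOME q. q \<in> path_class X x y p)"
    using someI[of "\<lambda>q. q \<in> path_class X x y p", OF path_class_self[OF assms]]
    by (simp add: path_class_def)
  then show ?thesis
    using assms edge_path_ends[OF X assms] path_value_cong
    by (auto simp: path_extension_def)
qed

lemma path_extension_in: "path_extension X C V M \<in> functors (path_category X) C"
proof (rule functors_path_categoryI[OF X])
  show "fob (path_extension X C V M) \<in> extensional (simps X 0)"
    "fmor (path_extension X C V M) \<in> extensional (arrows (path_category X))"
    by (simp_all add: path_extension_def)
  have ob: "fob (path_extension X C V M) x = V x" if "x \<in> simps X 0" for x
    using that by (simp add: path_extension_def)
  show "fob (path_extension X C V M) x \<in> ob C" if "x \<in> simps X 0" for x
    using that ob diagram_ob by simp
  show "fmor (path_extension X C V M) (x, y, path_class X x y p)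
      \<in> hom C (fob (path_extension X C V M) x) (fob (path_extension X C V M) y)"
    if "edge_path X x p y" for x y p
    using that edge_path_ends[OF X that] by (simp add: ob path_extension_class path_value_hom)
  show "fmor (path_extension X C V M) (x, x, path_class X x x []) =
      idt C (fob (path_extension X C V M) x)" if "x \<in> simps X 0" for x
    using that by (simp add: ob path_extension_class)
  show "fmor (path_extension X C V M) (x, z, path_class X x z (p @ q)) =
      cmp C (fob (path_extension X C V M) x) (fob (path_extension X C V M) y)
        (fob (path_extension X C V M) z)
        (fmor (path_extension X C V M) (y, z, path_class X y z q))
        (fmor (path_extension X C V M) (x, y, path_class X x y p))"
    if "edge_path X x p y" "edge_path X y q z" for x y z p q
    using that edge_path_ends[OF X that(1)] edge_path_ends[OF X that(2)]
    by (simp add: ob path_extension_class edge_path_append path_value_append)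
qed

end

text \<open>
  Since the edges generate the path category, naturality only has to be checked on them: a path is
  a composite of edges, and naturality squares can be pasted.
\<close>

lemma natural_iso_path_categoryI:
  assumes X: "simplicial_set X" and C: "category C"
    and F: "F \<in> functors (path_category X) C" and G: "G \<in> functors (path_category X) C"
    and iso: "\<And>x. x \<in> simps X 0 \<Longrightarrow> iso_in C (fob F x) (fob G x) (\<eta> x)"
    and nat: "\<And>e. e \<in> simps X 1 \<Longrightarrow>
      cmp C (fob F (src X e)) (fob F (tgt X e)) (fob G (tgt X e)) (\<eta> (tgt X e))
        (fmor F (src X e, tgt X e, path_class X (src X e) (tgt X e) [e])) =
      cmp C (fob F (src X e)) (fob G (src X e)) (fob G (tgt X e))
        (fmor G (src X e, tgt X e, path_class X (src X e) (tgt X e) [e])) (\<eta> (src X e))"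
  shows "natural_iso (path_category X) C F G \<eta>"
proof -
  let ?F = "\<lambda>x p y. fmor F (x, y, path_class X x y p)"
  let ?G = "\<lambda>x p y. fmor G (x, y, path_class X x y p)"
  have obF: "fob F x \<in> ob C" and obG: "fob G x \<in> ob C" and homE: "\<eta> x \<in> hom C (fob F x) (fob G x)"
    if "x \<in> simps X 0" for x
    using that functor_ob[OF F] functor_ob[OF G] iso by (auto simp: iso_in_def)
  have homF: "?F x p y \<in> hom C (fob F x) (fob F y)" and homG: "?G x p y \<in> hom C (fob G x) (fob G y)"
    if "edge_path X x p y" for x p y
    using that edge_path_ends[OF X that] functor_hom[OF F, of x y "path_class X x y p"]
      functor_hom[OF G, of x y "path_class X x y p"] by auto
  have square: "cmp C (fob F x) (fob F y) (fob G y) (\<eta> y) (?F x p y) =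
      cmp C (fob F x) (fob G x) (fob G y) (?G x p y) (\<eta> x)" if "edge_path X x p y" for x p y
    using that
  proof (induction p arbitrary: x)
    case Nil
    then show ?case
      using functor_id[OF F, of y] functor_id[OF G, of y] obF obG homE
      by (auto simp: cmp_id_left[OF C] cmp_id_right[OF C])
  next
    case (Cons e p)
    let ?z = "tgt X e"
    from Cons.prems have e: "e \<in> simps X 1" and x: "x = src X e" and p: "edge_path X ?z p y"
      by (auto simp: edge_path_Cons)
    note e' = edge_path_edge[OF X e, folded x]
    note ends = edge_path_ends[OF X e'] edge_path_ends[OF X p]
    have split: "path_class X x y (e # p) =
        cmp (path_category X) x ?z y (path_class X ?z y p) (path_class X x ?z [e])"
      using cmp_path_class[OF X e' p] by simp
    have F': "?F x (e # p) y = cmp C (fob F x) (fob F ?z) (fob F y) (?F ?z p y) (?F x [e] ?z)"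
      unfolding split using ends e' p by (intro functor_cmp[OF F]) auto
    have G': "?G x (e # p) y = cmp C (fob G x) (fob G ?z) (fob G y) (?G ?z p y) (?G x [e] ?z)"
      unfolding split using ends e' p by (intro functor_cmp[OF G]) auto
    show ?case
      unfolding F' G'
      by (rule iso_square_paste[OF C, symmetric])
        (use ends obF obG homE homF[OF e'] homG[OF e'] homF[OF p] homG[OF p] Cons.IH[OF p]
            nat[OF e, folded x] in auto)
  qed
  show ?thesis
    unfolding natural_iso_def using iso square by auto
qed

subsection \<open>Functoriality of the path category\<close>

lemma smap_src_tgt:
  assumes "g \<in> smaps X Y" "e \<in> simps X 1"
  shows "g 0 (src X e) = src Y (g 1 e)" "g 0 (tgt X e) = tgt Y (g 1 e)"
  using smap_subsimplex[OF assms] by auto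

lemma edge_path_map:
  assumes g: "g \<in> smaps X Y"
  shows "edge_path X x p y \<Longrightarrow> edge_path Y (g 0 x) (map (g 1) p) (g 0 y)"
proof (induction p arbitrary: x)
  case Nil
  then show ?case using smap_in[OF g] by auto
next
  case (Cons e p)
  then show ?case
    using smap_in[OF g, of e 1] smap_src_tgt[OF g, of e] Cons.IH[of "tgt X e"]
    by (auto simp: edge_path_Cons)
qed

lemma path_rel_map:
  assumes X: "simplicial_set X" and Y: "simplicial_set Y" and g: "g \<in> smaps X Y"
  shows "path_rel X x y p q \<Longrightarrow> path_rel Y (g 0 x) (g 0 y) (map (g 1) p) (map (g 1) q)"
proof (induction rule: path_rel.induct)
  case (refl x p y)
  then show ?case using edge_path_map[OF g] by (blast intro: path_rel.refl)
next
  case (sym x y p q)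
  then show ?case by (blast intro: path_rel.sym)
next
  case (trans x y p q r)
  then show ?case by (blast intro: path_rel.trans)
next
  case (cong x y p p' z q q')
  then show ?case by (simp add: path_rel.cong)
next
  case (triangle \<sigma>)
  then show ?case
    using path_rel_triangle[OF Y smap_in[OF g triangle]] X smap_subsimplex[OF g triangle]
    by (simp add: face_edge face_triangle subsimplex_subsimplex)
next
  case (degenerate x)
  then show ?case
    using path_rel_degenerate[OF smap_in[OF g degenerate]] smap_subsimplex[OF g degenerate]
    by (simp add: degeneracy_vertex)
qed

lemma path_functor_class:
  assumes X: "simplicial_set X" and Y: "simplicial_set Y" and g: "g \<in> smaps X Y"
    and p: "edge_path X x p y"
  shows "fmor (path_functor X Y g) (x, y, path_class X x y p) =
    path_class Y (g 0 x) (g 0 y) (map (g 1) p)"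
proof -
  have "path_class Y (g 0 x) (g 0 y) (map (g 1) q) = path_class Y (g 0 x) (g 0 y) (map (g 1) p)"
    if "q \<in> path_class X x y p" for q
    using that path_class_eqI[OF path_rel_map[OF X Y g, of x y p q]]
    by (simp add: path_class_def[of X])
  then have "(\<Union>q\<in>path_class X x y p. path_class Y (g 0 x) (g 0 y) (map (g 1) q)) =
      (\<Union>q\<in>path_class X x y p. path_class Y (g 0 x) (g 0 y) (map (g 1) p))"
    by (rule SUP_cong[OF HOL.refl])
  moreover have "fmor (path_functor X Y g) (x, y, path_class X x y p) =
      (\<Union>q\<in>path_class X x y p. path_class Y (g 0 x) (g 0 y) (map (g 1) q))"
    using edge_path_ends[OF X p] p by (auto simp: path_functor_def)
  ultimately show ?thesis
    using path_class_self[OF p] by blast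
qed

lemma path_functor_in:
  assumes X: "simplicial_set X" and Y: "simplicial_set Y" and g: "g \<in> smaps X Y"
  shows "path_functor X Y g \<in> functors (path_category X) (path_category Y)"
proof (rule functors_path_categoryI[OF X])
  show "fob (path_functor X Y g) \<in> extensional (simps X 0)"
    "fmor (path_functor X Y g) \<in> extensional (arrows (path_category X))"
    by (simp_all add: path_functor_def)
  have ob: "fob (path_functor X Y g) x = g 0 x" if "x \<in> simps X 0" for x
    using that by (simp add: path_functor_def)
  show "fob (path_functor X Y g) x \<in> ob (path_category Y)" if "x \<in> simps X 0" for x
    using that ob smap_in[OF g] by simp
  show "fmor (path_functor X Y g) (x, y, path_class X x y p)
      \<in> hom (path_category Y) (fob (path_functor X Y g) x) (fob (path_functor X Y g) y)"
    if "edge_path X x p y" for x y p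
    using that edge_path_ends[OF X that] edge_path_map[OF g that]
    by (auto simp: ob path_functor_class[OF assms])
  show "fmor (path_functor X Y g) (x, x, path_class X x x []) =
      idt (path_category Y) (fob (path_functor X Y g) x)" if "x \<in> simps X 0" for x
    using that by (simp add: ob path_functor_class[OF assms])
  show "fmor (path_functor X Y g) (x, z, path_class X x z (p @ q)) =
      cmp (path_category Y) (fob (path_functor X Y g) x) (fob (path_functor X Y g) y)
        (fob (path_functor X Y g) z)
        (fmor (path_functor X Y g) (y, z, path_class X y z q))
        (fmor (path_functor X Y g) (x, y, path_class X x y p))"
    if "edge_path X x p y" "edge_path X y q z" for x y z p q
    using that edge_path_ends[OF X that(1)] edge_path_ends[OF X that(2)]
    by (simp add: ob path_functor_class[OF assms] edge_path_append edge_path_map[OF g]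
        cmp_path_class[OF Y] del: One_nat_def)
qed


section \<open>Nerves\<close>

lemma ordinal_cat_simps [simp]:
  "ob (ordinal_cat n) = {..n}" "hom (ordinal_cat n) i j = (if i \<le> j then {()} else {})"
  "idt (ordinal_cat n) i = ()" "cmp (ordinal_cat n) i j k g f = ()"
  by (simp_all add: ordinal_cat_def)

lemma category_ordinal_cat: "category (ordinal_cat n)"
  unfolding category_def by simp

lemma ordinal_functor_in:
  "\<theta> \<in> simp_op m n \<Longrightarrow> ordinal_functor m \<theta> \<in> functors (ordinal_cat m) (ordinal_cat n)"
  by (rule functorsI)
    (auto simp: ordinal_functor_def simp_op_def PiE_def Pi_def mono_on_def split: if_splits)

lemma simps_nerve: "simps (nerve C) n = functors (ordinal_cat n) C"
  by (simp add: nerve_def)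

lemma nerve_ob: "S \<in> simps (nerve C) n \<Longrightarrow> i \<le> n \<Longrightarrow> fob S i \<in> ob C"
  using functor_ob[of S "ordinal_cat n" C i] by (simp add: simps_nerve)

lemma nerve_hom:
  "S \<in> simps (nerve C) n \<Longrightarrow> i \<le> j \<Longrightarrow> j \<le> n \<Longrightarrow> fmor S (i, j, ()) \<in> hom C (fob S i) (fob S j)"
  using functor_hom[of S "ordinal_cat n" C i j "()"] by (simp add: simps_nerve)

lemma nerve_id: "S \<in> simps (nerve C) n \<Longrightarrow> i \<le> n \<Longrightarrow> fmor S (i, i, ()) = idt C (fob S i)"
  using functor_id[of S "ordinal_cat n" C i] by (simp add: simps_nerve)

lemma nerve_cmp:
  "S \<in> simps (nerve C) n \<Longrightarrow> i \<le> j \<Longrightarrow> j \<le> k \<Longrightarrow> k \<le> n \<Longrightarrow> fmor S (i, k, ()) =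
    cmp C (fob S i) (fob S j) (fob S k) (fmor S (j, k, ())) (fmor S (i, j, ()))"
  using functor_cmp[of S "ordinal_cat n" C i j k "()" "()"] by (simp add: simps_nerve)

lemma nerve_eqI:
  assumes S: "S \<in> simps (nerve C) n" and T: "T \<in> simps (nerve D) n"
    and ob: "\<And>i. i \<le> n \<Longrightarrow> fob S i = fob T i"
    and mor: "\<And>i j. i \<le> j \<Longrightarrow> j \<le> n \<Longrightarrow> fmor S (i, j, ()) = fmor T (i, j, ())"
  shows "S = T"
proof -
  have ext: "fob S \<in> extensional {..n}" "fob T \<in> extensional {..n}"
    "fmor S \<in> extensional (arrows (ordinal_cat n))" "fmor T \<in> extensional (arrows (ordinal_cat n))"
    using S T by (simp_all add: simps_nerve functors_def PiE_def)
  have "fob S = fob T"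
    using ext(1,2) by (rule extensionalityI) (simp add: ob)
  moreover have "fmor S = fmor T"
    using ext(3,4) by (rule extensionalityI) (auto simp: arrows_def mor split: if_splits)
  ultimately show ?thesis
    by (cases S; cases T) simp
qed

definition nerve_simplex ::
  "nat \<Rightarrow> (nat \<Rightarrow> 'o) \<Rightarrow> (nat \<Rightarrow> nat \<Rightarrow> 'm) \<Rightarrow> (nat, unit, 'o, 'm) functor_data" where
  "nerve_simplex n a f =
     \<lparr>fob = (\<lambda>i\<in>{..n}. a i), fmor = (\<lambda>(i, j, _)\<in>arrows (ordinal_cat n). f i j)\<rparr>"

lemma fob_nerve_simplex [simp]: "i \<le> n \<Longrightarrow> fob (nerve_simplex n a f) i = a i"
  and fmor_nerve_simplex [simp]: "i \<le> j \<Longrightarrow> j \<le> n \<Longrightarrow> fmor (nerve_simplex n a f) (i, j, u) = f i j"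
  by (simp_all add: nerve_simplex_def)

lemma nerve_simplex_in:
  assumes "\<And>i. i \<le> n \<Longrightarrow> a i \<in> ob C"
    and "\<And>i j. i \<le> j \<Longrightarrow> j \<le> n \<Longrightarrow> f i j \<in> hom C (a i) (a j)"
    and "\<And>i. i \<le> n \<Longrightarrow> f i i = idt C (a i)"
    and "\<And>i j k. i \<le> j \<Longrightarrow> j \<le> k \<Longrightarrow> k \<le> n \<Longrightarrow> f i k = cmp C (a i) (a j) (a k) (f j k) (f i j)"
  shows "nerve_simplex n a f \<in> simps (nerve C) n"
  unfolding simps_nerve
proof (rule functorsI)
  show "fmor (nerve_simplex n a f) (i, k, cmp (ordinal_cat n) i j k h g) =
      cmp C (fob (nerve_simplex n a f) i) (fob (nerve_simplex n a f) j) (fob (nerve_simplex n a f) k)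
        (fmor (nerve_simplex n a f) (j, k, h)) (fmor (nerve_simplex n a f) (i, j, g))"
    if "i \<in> ob (ordinal_cat n)" "j \<in> ob (ordinal_cat n)" "k \<in> ob (ordinal_cat n)"
      "g \<in> hom (ordinal_cat n) i j" "h \<in> hom (ordinal_cat n) j k" for i j k g h
    using that assms(4)[of i j k] by (simp split: if_splits)
qed (use assms(1-3) in \<open>auto simp: nerve_simplex_def split: if_splits\<close>)

lemma act_nerve_in:
  "S \<in> simps (nerve C) n \<Longrightarrow> \<theta> \<in> simp_op m n \<Longrightarrow> act (nerve C) m n \<theta> S \<in> simps (nerve C) m"
  by (auto simp: nerve_def intro: comp_functor_in category_ordinal_cat ordinal_functor_in)

lemma fob_act_nerve: "i \<le> m \<Longrightarrow> fob (act (nerve C) m n \<theta> S) i = fob S (\<theta> i)"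
  by (simp add: nerve_def comp_functor_def ordinal_functor_def compose_def)

lemma fmor_act_nerve:
  "i \<le> j \<Longrightarrow> j \<le> m \<Longrightarrow> fmor (act (nerve C) m n \<theta> S) (i, j, ()) = fmor S (\<theta> i, \<theta> j, ())"
  by (simp add: nerve_def comp_functor_def ordinal_functor_def)

lemma simp_op_bounds:
  assumes "\<theta> \<in> simp_op m n" "i \<le> j" "j \<le> m"
  shows "\<theta> i \<le> \<theta> j" "\<theta> j \<le> n"
  using assms by (auto simp: simp_op_def mono_on_def)

lemma simp_op_compose:
  assumes "\<theta> \<in> simp_op m n" "\<tau> \<in> simp_op k m"
  shows "compose {..k} \<theta> \<tau> \<in> simp_op k n"
proof -
  have "\<theta> (\<tau> a) \<le> \<theta> (\<tau> b)" if "a \<le> b" "b \<le> k" for a b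
    using simp_op_bounds[OF assms(1)] simp_op_bounds[OF assms(2) that] by blast
  moreover have "\<theta> (\<tau> b) \<le> n" if "b \<le> k" for b
    using simp_op_bounds(2)[OF assms(1) order.refl] simp_op_bounds(2)[OF assms(2) order.refl that]
    by blast
  ultimately show ?thesis
    by (auto simp: simp_op_def compose_def mono_on_def)
qed

lemma simplicial_set_nerve: "simplicial_set (nerve C)"
  unfolding simplicial_set_def
proof (intro conjI allI ballI Pi_I)
  fix m n \<theta> S
  assume "\<theta> \<in> simp_op m n" "S \<in> simps (nerve C) n"
  then show "act (nerve C) m n \<theta> S \<in> simps (nerve C) m"
    by (simp add: act_nerve_in)
next
  fix n S
  assume S: "S \<in> simps (nerve C) n"
  moreover have "(\<lambda>i\<in>{..n}. i) \<in> simp_op n n"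
    by (auto simp: simp_op_def mono_on_def)
  ultimately show "act (nerve C) n n (\<lambda>i\<in>{..n}. i) S = S"
    by (intro nerve_eqI[OF act_nerve_in S]) (simp_all add: fob_act_nerve fmor_act_nerve)
next
  fix k m n \<tau> \<theta> S
  assume t: "\<tau> \<in> simp_op k m" "\<theta> \<in> simp_op m n" and S: "S \<in> simps (nerve C) n"
  have "\<tau> i \<le> \<tau> j" "\<tau> j \<le> m" "\<tau> i \<le> m" if "i \<le> j" "j \<le> k" for i j
    using simp_op_bounds[OF t(1) that] by auto
  then show "act (nerve C) k n (compose {..k} \<theta> \<tau>) S =
      act (nerve C) k m \<tau> (act (nerve C) m n \<theta> S)"
    using S t simp_op_compose[OF t(2,1)]
    by (intro nerve_eqI[OF act_nerve_in act_nerve_in] act_nerve_in)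
      (auto simp: fob_act_nerve fmor_act_nerve compose_def)
qed

subsection \<open>Maps into a nerve\<close>

text \<open>
  A map into a nerve is determined by the diagram of its values on vertices and edges, and this
  diagram satisfies the relations of the path category.
\<close>

definition vertex_value :: "(nat \<Rightarrow> 'a \<Rightarrow> (nat, unit, 'o, 'm) functor_data) \<Rightarrow> 'a \<Rightarrow> 'o" where
  "vertex_value v x = fob (v 0 x) 0"

definition edge_value :: "(nat \<Rightarrow> 'a \<Rightarrow> (nat, unit, 'o, 'm) functor_data) \<Rightarrow> 'a \<Rightarrow> 'm" where
  "edge_value v e = fmor (v 1 e) (0, 1, ())"

lemma fob_smap_nerve:
  assumes v: "v \<in> smaps W (nerve C)" and w: "w \<in> simps W n" and i: "i \<le> n"
  shows "fob (v n w) i = vertex_value v (subsimplex W n [i] w)"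
proof -
  have "v 0 (subsimplex W n [i] w) = subsimplex (nerve C) n [i] (v n w)"
    using smap_subsimplex[OF v w] i by simp
  then show ?thesis
    by (simp add: vertex_value_def subsimplex_def fob_act_nerve list_op_def)
qed

lemma fmor_smap_nerve:
  assumes v: "v \<in> smaps W (nerve C)" and w: "w \<in> simps W n" and ij: "i \<le> j" "j \<le> n"
  shows "fmor (v n w) (i, j, ()) = edge_value v (subsimplex W n [i, j] w)"
proof -
  have "v 1 (subsimplex W n [i, j] w) = subsimplex (nerve C) n [i, j] (v n w)"
    using smap_subsimplex[OF v w] ij by simp
  then show ?thesis
    by (simp add: edge_value_def subsimplex_def fmor_act_nerve list_op_def)
qed

lemma path_diagram_smap:
  assumes v: "v \<in> smaps W (nerve C)"
  shows "path_diagram W C (vertex_value v) (edge_value v)"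
  unfolding path_diagram_def
proof (intro conjI ballI)
  show "vertex_value v x \<in> ob C" if "x \<in> simps W 0" for x
    using nerve_ob[OF smap_in[OF v that]] by (simp add: vertex_value_def)
  show "edge_value v e \<in> hom C (vertex_value v (src W e)) (vertex_value v (tgt W e))"
    if "e \<in> simps W 1" for e
    using nerve_hom[OF smap_in[OF v that], of 0 1] fob_smap_nerve[OF v that]
    by (simp add: edge_value_def)
  show "edge_value v (subsimplex W 0 [0, 0] x) = idt C (vertex_value v x)" if "x \<in> simps W 0" for x
    using nerve_id[OF smap_in[OF v that]] fmor_smap_nerve[OF v that]
    by (simp add: vertex_value_def)
  show "edge_value v (subsimplex W 2 [0, 2] s) =
      cmp C (vertex_value v (subsimplex W 2 [0] s)) (vertex_value v (subsimplex W 2 [1] s))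
        (vertex_value v (subsimplex W 2 [2] s))
        (edge_value v (subsimplex W 2 [1, 2] s)) (edge_value v (subsimplex W 2 [0, 1] s))"
    if "s \<in> simps W 2" for s
    using nerve_cmp[OF smap_in[OF v that], of 0 1 2] fob_smap_nerve[OF v that]
      fmor_smap_nerve[OF v that] by simp
qed

definition nerve_map :: "('o, 'm) cat \<Rightarrow> ('o, 'm, 'p, 'n) functor_data
    \<Rightarrow> nat \<Rightarrow> (nat, unit, 'o, 'm) functor_data \<Rightarrow> (nat, unit, 'p, 'n) functor_data" where
  "nerve_map C F n = (\<lambda>S\<in>simps (nerve C) n. comp_functor (ordinal_cat n) F S)"

lemma fob_nerve_map: "S \<in> simps (nerve C) n \<Longrightarrow> i \<le> n \<Longrightarrow> fob (nerve_map C F n S) i = fob F (fob S i)"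
  by (simp add: nerve_map_def comp_functor_def compose_def)

lemma fmor_nerve_map:
  "S \<in> simps (nerve C) n \<Longrightarrow> i \<le> j \<Longrightarrow> j \<le> n \<Longrightarrow>
    fmor (nerve_map C F n S) (i, j, ()) = fmor F (fob S i, fob S j, fmor S (i, j, ()))"
  by (simp add: nerve_map_def comp_functor_def)

lemma nerve_map_in:
  assumes F: "F \<in> functors C D"
  shows "nerve_map C F \<in> smaps (nerve C) (nerve D)"
proof (rule smapsI)
  show "nerve_map C F n \<in> extensional (simps (nerve C) n)" for n
    by (simp add: nerve_map_def)
  show in_D: "nerve_map C F n S \<in> simps (nerve D) n" if "S \<in> simps (nerve C) n" for n S
    using that by (simp add: nerve_map_def comp_functor_in[OF category_ordinal_cat _ F] simps_nerve)
  show "nerve_map C F m (act (nerve C) m n \<theta> S) = act (nerve D) m n \<theta> (nerve_map C F n S)"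
    if t: "\<theta> \<in> simp_op m n" and S: "S \<in> simps (nerve C) n" for m n \<theta> S
  proof (rule nerve_eqI)
    note act = act_nerve_in[OF S t]
    show "nerve_map C F m (act (nerve C) m n \<theta> S) \<in> simps (nerve D) m"
      by (rule in_D[OF act])
    show "act (nerve D) m n \<theta> (nerve_map C F n S) \<in> simps (nerve D) m"
      by (rule act_nerve_in[OF in_D[OF S] t])
    show "fob (nerve_map C F m (act (nerve C) m n \<theta> S)) i =
        fob (act (nerve D) m n \<theta> (nerve_map C F n S)) i" if "i \<le> m" for i
      using that simp_op_bounds[OF t, of i i] S act by (simp add: fob_nerve_map fob_act_nerve)
    show "fmor (nerve_map C F m (act (nerve C) m n \<theta> S)) (i, j, ()) =
        fmor (act (nerve D) m n \<theta> (nerve_map C F n S)) (i, j, ())" if "i \<le> j" "j \<le> m" for i j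
      using that simp_op_bounds[OF t that] S act
      by (simp add: fob_act_nerve fmor_nerve_map fmor_act_nerve)
  qed
qed

subsection \<open>The unit of the adjunction\<close>

definition path_unit :: "'a sset \<Rightarrow> nat \<Rightarrow> 'a \<Rightarrow> (nat, unit, 'a, 'a list set) functor_data" where
  "path_unit X n = (\<lambda>x\<in>simps X n. nerve_simplex n (\<lambda>i. subsimplex X n [i] x)
     (\<lambda>i j. path_class X (subsimplex X n [i] x) (subsimplex X n [j] x) [subsimplex X n [i, j] x]))"

lemma path_class_degenerate_edge:
  assumes X: "simplicial_set X" and x: "x \<in> simps X n" and i: "i \<le> n"
  shows "path_class X (subsimplex X n [i] x) (subsimplex X n [i] x) [subsimplex X n [i, i] x] =
    path_class X (subsimplex X n [i] x) (subsimplex X n [i] x) []"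
proof (rule path_class_eqI)
  have "subsimplex X 0 [0, 0] (subsimplex X n [i] x) = subsimplex X n [i, i] x"
    using i by (simp add: subsimplex_subsimplex[OF X x])
  then show "path_rel X (subsimplex X n [i] x) (subsimplex X n [i] x) [subsimplex X n [i, i] x] []"
    using path_rel_degenerate[of "subsimplex X n [i] x" X] i subsimplex_in[OF X x, of "[i]" 0] by simp
qed

lemma path_class_triangle:
  assumes X: "simplicial_set X" and x: "x \<in> simps X n" and ijk: "i \<le> j" "j \<le> k" "k \<le> n"
  shows "path_class X (subsimplex X n [i] x) (subsimplex X n [k] x) [subsimplex X n [i, k] x] =
    path_class X (subsimplex X n [i] x) (subsimplex X n [k] x)
      [subsimplex X n [i, j] x, subsimplex X n [j, k] x]"
proof (rule path_class_eqI)
  let ?s = "subsimplex X n [i, j, k] x"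
  have s: "?s \<in> simps X 2"
    using ijk by (intro subsimplex_in[OF X x]) auto
  have "subsimplex X 2 ys ?s = subsimplex X n (map ((!) [i, j, k]) ys) x"
    if "ys \<noteq> []" "sorted ys" "set ys \<subseteq> {..2}" for ys
    using ijk that by (intro subsimplex_subsimplex[OF X x]) auto
  then show "path_rel X (subsimplex X n [i] x) (subsimplex X n [k] x) [subsimplex X n [i, k] x]
      [subsimplex X n [i, j] x, subsimplex X n [j, k] x]"
    using path_rel_triangle[OF X s] by simp
qed

text \<open>
  The edges of a simplex form a functor into the path category because its degenerate edges and its
  triangles are relations there.
\<close>

lemma path_unit_simplex:
  assumes X: "simplicial_set X" and x: "x \<in> simps X n"
  shows "path_unit X n x \<in> simps (nerve (path_category X)) n"
proof -
  let ?v = "\<lambda>i. subsimplex X n [i] x" and ?e = "\<lambda>i j. subsimplex X n [i, j] x"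
  note edge = edge_path_edge_of_simplex[OF X x]
  have "nerve_simplex n ?v (\<lambda>i j. path_class X (?v i) (?v j) [?e i j])
      \<in> simps (nerve (path_category X)) n"
  proof (rule nerve_simplex_in)
    show "?v i \<in> ob (path_category X)" if "i \<le> n" for i
      using that by (simp add: subsimplex_in[OF X x])
    show "path_class X (?v i) (?v j) [?e i j] \<in> hom (path_category X) (?v i) (?v j)"
      if "i \<le> j" "j \<le> n" for i j
      using edge[OF that] by (simp only: path_category_simps) blast
    show "path_class X (?v i) (?v i) [?e i i] = idt (path_category X) (?v i)" if "i \<le> n" for i
      using path_class_degenerate_edge[OF X x that] by simp
    show "path_class X (?v i) (?v k) [?e i k] = cmp (path_category X) (?v i) (?v j) (?v k)
        (path_class X (?v j) (?v k) [?e j k]) (path_class X (?v i) (?v j) [?e i j])"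
      if "i \<le> j" "j \<le> k" "k \<le> n" for i j k
      using that cmp_path_class[OF X edge edge, of i j k] path_class_triangle[OF X x that] by simp
  qed
  then show ?thesis
    using x by (simp add: path_unit_def)
qed

lemma path_unit_in:
  assumes X: "simplicial_set X"
  shows "path_unit X \<in> smaps X (nerve (path_category X))"
proof (rule smapsI)
  show "path_unit X n \<in> extensional (simps X n)" for n
    by (simp add: path_unit_def)
  show "path_unit X n x \<in> simps (nerve (path_category X)) n" if "x \<in> simps X n" for n x
    by (rule path_unit_simplex[OF X that])
  show "path_unit X m (act X m n \<theta> x) = act (nerve (path_category X)) m n \<theta> (path_unit X n x)"
    if t: "\<theta> \<in> simp_op m n" and x: "x \<in> simps X n" for m n \<theta> x
  proof (rule nerve_eqI)
    note tx = simplicial_set_act[OF X t x]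
    show "path_unit X m (act X m n \<theta> x) \<in> simps (nerve (path_category X)) m"
      by (rule path_unit_simplex[OF X tx])
    show "act (nerve (path_category X)) m n \<theta> (path_unit X n x) \<in> simps (nerve (path_category X)) m"
      by (rule act_nerve_in[OF path_unit_simplex[OF X x] t])
    show "fob (path_unit X m (act X m n \<theta> x)) i =
        fob (act (nerve (path_category X)) m n \<theta> (path_unit X n x)) i" if "i \<le> m" for i
      using that simp_op_bounds[OF t, of i i] tx x
      by (simp add: path_unit_def fob_act_nerve subsimplex_act[OF X x t])
    show "fmor (path_unit X m (act X m n \<theta> x)) (i, j, ()) =
        fmor (act (nerve (path_category X)) m n \<theta> (path_unit X n x)) (i, j, ())"
      if "i \<le> j" "j \<le> m" for i j
      using that simp_op_bounds[OF t that] tx x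
      by (simp add: path_unit_def fmor_act_nerve subsimplex_act[OF X x t])
  qed
qed

lemma subsimplex_edge:
  assumes "simplicial_set X" "e \<in> simps X 1"
  shows "subsimplex X 1 [0, 1] e = e"
proof -
  have "list_op [0, 1] = (\<lambda>i\<in>{..1}. i)"
    by (auto simp: list_op_def fun_eq_iff le_Suc_eq)
  moreover have "act X 1 1 (\<lambda>i\<in>{..1}. i) e = e"
    using assms unfolding simplicial_set_def by blast
  ultimately show ?thesis
    by (simp add: subsimplex_def)
qed

lemma vertex_value_unit: "simplicial_set X \<Longrightarrow> x \<in> simps X 0 \<Longrightarrow> vertex_value (path_unit X) x = x"
  by (simp add: vertex_value_def path_unit_def subsimplex_vertex)

lemma edge_value_unit:
  "simplicial_set X \<Longrightarrow> e \<in> simps X 1 \<Longrightarrow>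
    edge_value (path_unit X) e = path_class X (src X e) (tgt X e) [e]"
  using subsimplex_edge[of X e] by (simp add: edge_value_def path_unit_def)

text \<open>Naturality of the unit: both sides send a simplex \<open>x\<close> to the classes of the edges of \<open>g x\<close>.\<close>

lemma path_unit_natural:
  assumes X: "simplicial_set X" and Y: "simplicial_set Y" and g: "g \<in> smaps X Y"
  shows "smap_comp X (nerve_map (path_category X) (path_functor X Y g)) (path_unit X) =
    smap_comp X (path_unit Y) g"
proof (rule smap_eqI)
  note F = path_functor_in[OF assms]
  show l: "smap_comp X (nerve_map (path_category X) (path_functor X Y g)) (path_unit X)
      \<in> smaps X (nerve (path_category Y))"
    by (rule smap_comp_in[OF X path_unit_in[OF X] nerve_map_in[OF F]])
  show r: "smap_comp X (path_unit Y) g \<in> smaps X (nerve (path_category Y))"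
    by (rule smap_comp_in[OF X g path_unit_in[OF Y]])
  fix n x
  assume x: "x \<in> simps X n"
  note gx = smap_in[OF g x] and ux = path_unit_simplex[OF X x]
  have v: "subsimplex X n [i] x \<in> simps X 0" "subsimplex Y n [i] (g n x) = g 0 (subsimplex X n [i] x)"
    if "i \<le> n" for i
    using that smap_subsimplex[OF g x, of "[i]"] by (simp_all add: subsimplex_in[OF X x])
  have e: "subsimplex Y n [i, j] (g n x) = g 1 (subsimplex X n [i, j] x)" if "i \<le> j" "j \<le> n" for i j
    using that smap_subsimplex[OF g x, of "[i, j]"] by simp
  show "smap_comp X (nerve_map (path_category X) (path_functor X Y g)) (path_unit X) n x =
      smap_comp X (path_unit Y) g n x"
  proof (rule nerve_eqI[OF smap_in[OF l x] smap_in[OF r x]])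
    show "fob (smap_comp X (nerve_map (path_category X) (path_functor X Y g)) (path_unit X) n x) i =
        fob (smap_comp X (path_unit Y) g n x) i" if "i \<le> n" for i
      using that x gx ux v[OF that]
      by (simp add: smap_comp_apply fob_nerve_map) (simp add: path_unit_def path_functor_def)
    show "fmor (smap_comp X (nerve_map (path_category X) (path_functor X Y g)) (path_unit X) n x)
        (i, j, ()) = fmor (smap_comp X (path_unit Y) g n x) (i, j, ())" if "i \<le> j" "j \<le> n" for i j
      using that x gx ux v e path_functor_class[OF assms edge_path_edge_of_simplex[OF X x that]]
      by (simp add: smap_comp_apply fmor_nerve_map) (simp add: path_unit_def)
  qed
qed


section \<open>The nerve of a category is a quasi-category\<close>

text \<open>Lifting against the map to the point is extension from the horn to the simplex.\<close>

lemma quasi_category_iff: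
  "quasi_category Z \<longleftrightarrow> simplicial_set Z \<and>
     (\<forall>n k. 0 < k \<and> k < n \<longrightarrow> (\<forall>u\<in>smaps (horn n k) Z. \<exists>l\<in>smaps (std_simplex n) Z.
        \<forall>m. \<forall>\<theta>\<in>simps (horn n k) m. l m \<theta> = u m \<theta>))"
proof -
  have "has_rlp (horn n k) (std_simplex n) (horn_incl n k) Z spoint (to_spoint Z) \<longleftrightarrow>
      (\<forall>u\<in>smaps (horn n k) Z. \<exists>l\<in>smaps (std_simplex n) Z.
        \<forall>m. \<forall>\<theta>\<in>simps (horn n k) m. l m \<theta> = u m \<theta>)" (is "?L \<longleftrightarrow> ?R") for n k
  proof -
    have point: "smap_comp A (to_spoint Z) f = smap_comp A v i"
      if "f \<in> smaps A Z" for A :: "(nat \<Rightarrow> nat) sset" and f v and i :: "nat \<Rightarrow> (nat \<Rightarrow> nat) \<Rightarrow> nat \<Rightarrow> nat"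
      using that by (auto simp: smap_comp_def compose_def to_spoint_def fun_eq_iff)
    have restr: "smap_comp (horn n k) l (horn_incl n k) = u \<longleftrightarrow>
        (\<forall>m. \<forall>\<theta>\<in>simps (horn n k) m. l m \<theta> = u m \<theta>)" if "u \<in> smaps (horn n k) Z" for l u
      using smap_ext[OF that] by (auto simp: smap_comp_def compose_def horn_incl_def fun_eq_iff)
    have "to_spoint (std_simplex n) \<in> smaps (std_simplex n) spoint"
      by (rule smapsI) (auto simp: to_spoint_def spoint_def)
    then show ?thesis
      unfolding has_rlp_def using point restr by (auto simp: fun_eq_iff)
  qed
  then show ?thesis
    unfolding quasi_category_def by simp
qed

lemma act_std_simplex [simp]: "act (std_simplex n) m k \<tau> \<theta> = compose {..m} \<theta> \<tau>"
  and act_horn [simp]: "act (horn n j) m k \<tau> \<theta> = compose {..m} \<theta> \<tau>"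
  and simps_std_simplex [simp]: "simps (std_simplex n) m = simp_op m n"
  by (simp_all add: std_simplex_def horn_def)

lemma simps_horn: "simps (horn n k) m = {\<theta> \<in> simp_op m n. \<exists>i\<le>n. i \<noteq> k \<and> i \<notin> \<theta> ` {..m}}"
  by (simp add: horn_def)

lemma simplicial_set_std_simplex: "simplicial_set (std_simplex n)"
proof -
  have "compose {..m} \<theta> (\<lambda>i\<in>{..m}. i) = \<theta>" if "\<theta> \<in> simp_op m n" for m \<theta>
    using that by (intro compose_Id) (auto simp: simp_op_def PiE_def)
  moreover have "compose {..k} \<theta> (compose {..k} \<tau> \<sigma>) = compose {..k} (compose {..m} \<theta> \<tau>) \<sigma>"
    if "\<sigma> \<in> simp_op k m" for k m and \<theta> \<tau> \<sigma> :: "nat \<Rightarrow> nat"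
    using that by (intro compose_assoc[of _ _ "{..m}"]) (auto simp: simp_op_def PiE_def)
  ultimately show ?thesis
    unfolding simplicial_set_def by (auto simp: simp_op_compose)
qed

lemma simplicial_set_horn: "simplicial_set (horn n k)"
proof -
  have "compose {..m} \<theta> \<tau> \<in> simps (horn n k) m"
    if "\<theta> \<in> simps (horn n k) p" "\<tau> \<in> simp_op m p" for m p \<theta> \<tau>
  proof -
    have "\<tau> a \<in> {..p}" if "a \<in> {..m}" for a
      using \<open>\<tau> \<in> simp_op m p\<close> that by (auto simp: simp_op_def PiE_def)
    then show ?thesis
      using that simp_op_compose[of \<theta> p n \<tau> m] by (force simp: simps_horn compose_def)
  qed
  then show ?thesis
    using simplicial_set_std_simplex[of n] unfolding simplicial_set_def
    by (auto simp: simps_horn Pi_iff)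
qed

lemma list_op_in_horn:
  assumes "length xs = Suc m" "sorted xs" "set xs \<subseteq> {..n}" "i \<le> n" "i \<noteq> k" "i \<notin> set xs"
  shows "list_op xs \<in> simps (horn n k) m"
proof -
  have "list_op xs ` {..m} = set xs"
    using list_op_image[of xs] assms(1) by force
  then show ?thesis
    using list_op_in_simp_op[OF assms(1-3)] assms(4-6) by (auto simp: simps_horn)
qed

lemma subsimplex_horn: "xs \<noteq> [] \<Longrightarrow> subsimplex (horn n k) m xs \<theta> = list_op (map \<theta> xs)"
  by (simp add: subsimplex_def compose_list_op[simplified])

text \<open>
  A map \<open>u\<close> from an inner horn to a nerve extends over the simplex. The edge from \<open>i\<close> to \<open>j\<close> is sent
  to \<open>u\<^sub>k\<^sub>j \<cdot> u\<^sub>i\<^sub>k\<close> if \<open>i \<le> k \<le> j\<close> and to \<open>u\<^sub>i\<^sub>j\<close> otherwise. Only edges through \<open>k\<close> and edges on one side of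
  \<open>k\<close> occur here. These lie in the horn for every \<open>n\<close>, as do the triangles on one side of \<open>k\<close>, because
  \<open>0\<close> and \<open>n\<close> differ from \<open>k\<close>; so the same formula serves the case \<open>n = 2\<close>, where it composes the two
  given edges, and higher \<open>n\<close>, where the extension is already determined by the horn.
\<close>

lemma inner_horn_filler_nerve:
  assumes C: "category C" and k: "0 < k" "k < n" and u: "u \<in> smaps (horn n k) (nerve C)"
  obtains l where "l \<in> smaps (std_simplex n) (nerve C)"
    "\<And>m \<theta>. \<theta> \<in> simps (horn n k) m \<Longrightarrow> l m \<theta> = u m \<theta>"
proof -
  define good where "good xs \<longleftrightarrow> (\<exists>i\<le>n. i \<noteq> k \<and> i \<notin> set xs)" for xs
  define V where "V i = vertex_value u (list_op [i])" for i
  define U where "U i j = edge_value u (list_op [i, j])" for i j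
  define F where "F i j = (if i \<le> k \<and> k \<le> j then cmp C (V i) (V k) (V j) (U k j) (U i k) else U i j)"
    for i j
  \<comment> \<open>The operator with values \<open>xs\<close> lies in the horn iff \<open>xs\<close> is good.\<close>
  have low: "good xs" if "\<forall>x\<in>set xs. x < n" for xs
    using that k unfolding good_def by (intro exI[of _ n]) auto
  have high: "good xs" if "\<forall>x\<in>set xs. 0 < x" for xs
    using that k unfolding good_def by (intro exI[of _ 0]) auto
  have point: "good [i]" "good [i, i]" for i
    using low[of "[i]"] low[of "[i, i]"] high[of "[i]"] high[of "[i, i]"] k
    by (cases "i = 0"; force)+
  have horn: "list_op xs \<in> simps (horn n k) m"
    if "length xs = Suc m" "sorted xs" "set xs \<subseteq> {..n}" "good xs" for xs m
    using that list_op_in_horn unfolding good_def by blast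
  note diagram = path_diagram_smap[OF u, unfolded path_diagram_def]

  have V_ob: "V i \<in> ob C" if "i \<le> n" for i
    using diagram horn[of "[i]" 0] that point unfolding V_def by simp
  have U_hom: "U i j \<in> hom C (V i) (V j)" if "i \<le> j" "j \<le> n" "good [i, j]" for i j
  proof -
    have "list_op [i, j] \<in> simps (horn n k) 1"
      using horn[of "[i, j]" 1] that by simp
    then have "edge_value u (list_op [i, j]) \<in> hom C (vertex_value u (src (horn n k) (list_op [i, j])))
        (vertex_value u (tgt (horn n k) (list_op [i, j])))"
      using diagram by blast
    then show ?thesis
      unfolding U_def V_def by (simp add: subsimplex_horn list_op_def)
  qed
  have U_id: "U i i = idt C (V i)" if "i \<le> n" for i
  proof -
    have "list_op [i] \<in> simps (horn n k) 0"
      using horn[of "[i]" 0] that point by simp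
    then have "edge_value u (subsimplex (horn n k) 0 [0, 0] (list_op [i])) =
        idt C (vertex_value u (list_op [i]))"
      using diagram by blast
    then show ?thesis
      unfolding U_def V_def by (simp add: subsimplex_horn list_op_def)
  qed
  have U_cmp: "U i l = cmp C (V i) (V j) (V l) (U j l) (U i j)"
    if "i \<le> j" "j \<le> l" "l \<le> n" "good [i, j, l]" for i j l
  proof -
    have "list_op [i, j, l] \<in> simps (horn n k) 2"
      using horn[of "[i, j, l]" 2] that by simp
    then have "edge_value u (subsimplex (horn n k) 2 [0, 2] (list_op [i, j, l])) =
        cmp C (vertex_value u (subsimplex (horn n k) 2 [0] (list_op [i, j, l])))
          (vertex_value u (subsimplex (horn n k) 2 [1] (list_op [i, j, l])))
          (vertex_value u (subsimplex (horn n k) 2 [2] (list_op [i, j, l])))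
          (edge_value u (subsimplex (horn n k) 2 [1, 2] (list_op [i, j, l])))
          (edge_value u (subsimplex (horn n k) 2 [0, 1] (list_op [i, j, l])))"
      using diagram by blast
    moreover have "list_op [i, j, l] 0 = i" "list_op [i, j, l] 1 = j" "list_op [i, j, l] 2 = l"
      by (simp_all add: list_op_def)
    ultimately show ?thesis
      unfolding U_def V_def by (simp add: subsimplex_horn)
  qed

  \<comment> \<open>On edges of the horn the extension agrees with \<open>u\<close>: if \<open>i < k < j\<close>, a vertex missed by \<open>i, j\<close>
    and different from \<open>k\<close> is also missed by the triangle \<open>i, k, j\<close>.\<close>
  have F_good: "F i j = U i j" if "i \<le> j" "j \<le> n" "good [i, j]" for i j
  proof (cases "i \<le> k \<and> k \<le> j")
    case True
    consider "k = i" | "k = j" | "i < k" "k < j"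
      using True by linarith
    then have "good [i, k, j]"
    proof cases
      case 3
      then show ?thesis using that(3) unfolding good_def by auto
    qed (use that(3) in \<open>simp_all add: good_def\<close>)
    then show ?thesis
      using True that U_cmp[of i k j] by (simp add: F_def)
  qed (auto simp: F_def)
  have low_edge: "U i j \<in> hom C (V i) (V j)" if "i \<le> j" "j \<le> k" for i j
    using that k by (intro U_hom low) auto
  have high_edge: "U i j \<in> hom C (V i) (V j)" if "k \<le> i" "i \<le> j" "j \<le> n" for i j
    using that k by (intro U_hom high) auto
  have F_hom: "F i j \<in> hom C (V i) (V j)" if "i \<le> j" "j \<le> n" for i j
  proof (cases "i \<le> k \<and> k \<le> j")
    case True
    then show ?thesis
      unfolding F_def using that k cmp_in_hom[OF C V_ob V_ob V_ob low_edge[of i k] high_edge[of k j]]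
      by simp
  next
    case False
    then show ?thesis
      unfolding F_def using that low_edge[of i j] high_edge[of i j] by auto
  qed
  have F_cmp: "F i l = cmp C (V i) (V j) (V l) (F j l) (F i j)"
    if ijl: "i \<le> j" "j \<le> l" "l \<le> n" for i j l
  proof -
    have ob: "V i \<in> ob C" "V j \<in> ob C" "V l \<in> ob C" "V k \<in> ob C"
      using ijl k by (auto intro: V_ob)
    \<comment> \<open>Only the position of \<open>k\<close> matters: outside \<open>i..l\<close> the triangle \<open>i, j, l\<close> is in the horn; otherwise
      associativity reduces the claim to the triangle \<open>k, j, l\<close> or \<open>i, j, k\<close> on one side of \<open>k\<close>.\<close>
    consider "l < k" | "k < i" | "i \<le> k" "k \<le> j" | "j < k" "k \<le> l"
      using ijl by linarith
    then show ?thesis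
    proof cases
      case 1
      then have "good [i, j, l]"
        using ijl k by (intro low) auto
      then show ?thesis
        using 1 ijl U_cmp[of i j l] by (simp add: F_def)
    next
      case 2
      then have "good [i, j, l]"
        using ijl k by (intro high) auto
      then show ?thesis
        using 2 ijl U_cmp[of i j l] by (simp add: F_def)
    next
      case 3
      have "good [k, j, l]" "good [j, l]"
        using 3 ijl k high[of "[k, j, l]"] high[of "[j, l]"] by auto
      then have "cmp C (V i) (V k) (V l) (U k l) (U i k) =
          cmp C (V i) (V k) (V l) (cmp C (V k) (V j) (V l) (F j l) (U k j)) (U i k)"
        using U_cmp[of k j l] F_good[of j l] 3 ijl by simp
      also have "\<dots> = cmp C (V i) (V j) (V l) (F j l) (cmp C (V i) (V k) (V j) (U k j) (U i k))"
        using 3 ijl ob by (intro cmp_assoc[OF C] low_edge high_edge F_hom) auto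
      finally show ?thesis
        using 3 ijl by (simp add: F_def)
    next
      case 4
      have "good [i, j, k]" "good [i, j]"
        using 4 ijl k low[of "[i, j, k]"] low[of "[i, j]"] by auto
      then have "cmp C (V i) (V k) (V l) (U k l) (U i k) =
          cmp C (V i) (V k) (V l) (U k l) (cmp C (V i) (V j) (V k) (U j k) (F i j))"
        using U_cmp[of i j k] F_good[of i j] 4 ijl k by simp
      also have "\<dots> = cmp C (V i) (V j) (V l) (cmp C (V j) (V k) (V l) (U k l) (U j k)) (F i j)"
        using 4 ijl ob k by (intro cmp_assoc[OF C, symmetric] low_edge high_edge F_hom) auto
      finally show ?thesis
        using 4 ijl by (simp add: F_def)
    qed
  qed

  define l where "l m = (\<lambda>\<theta>\<in>simp_op m n. nerve_simplex m (\<lambda>a. V (\<theta> a)) (\<lambda>a b. F (\<theta> a) (\<theta> b)))" for m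
  have l_in: "l m \<theta> \<in> simps (nerve C) m" if t: "\<theta> \<in> simp_op m n" for m \<theta>
  proof -
    have bound: "\<theta> a \<le> n" if "a \<le> m" for a
      using simp_op_bounds(2)[OF t _ that] by blast
    have "F (\<theta> a) (\<theta> a) = idt C (V (\<theta> a))" if "a \<le> m" for a
      using bound[OF that] F_good U_id point by simp
    then have "nerve_simplex m (\<lambda>a. V (\<theta> a)) (\<lambda>a b. F (\<theta> a) (\<theta> b)) \<in> simps (nerve C) m"
      using bound simp_op_bounds[OF t] by (intro nerve_simplex_in V_ob F_hom F_cmp) auto
    then show ?thesis
      using t by (simp add: l_def)
  qed
  have "l \<in> smaps (std_simplex n) (nerve C)"
  proof (rule smapsI)
    show "l m \<in> extensional (simps (std_simplex n) m)" for m
      by (simp add: l_def)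
    show "l m \<theta> \<in> simps (nerve C) m" if "\<theta> \<in> simps (std_simplex n) m" for m \<theta>
      using that l_in by simp
    show "l p (act (std_simplex n) p m \<tau> \<theta>) = act (nerve C) p m \<tau> (l m \<theta>)"
      if t: "\<tau> \<in> simp_op p m" and "\<theta> \<in> simps (std_simplex n) m" for p m \<tau> \<theta>
    proof -
      from that have th: "\<theta> \<in> simp_op m n" by simp
      note comp = simp_op_compose[OF th t]
      have "\<tau> a \<le> \<tau> b" "\<tau> b \<le> m" "\<tau> a \<le> m" if "a \<le> b" "b \<le> p" for a b
        using simp_op_bounds[OF t that] by auto
      then have "l p (compose {..p} \<theta> \<tau>) = act (nerve C) p m \<tau> (l m \<theta>)"
        using comp th
        by (intro nerve_eqI[OF l_in[OF comp] act_nerve_in[OF l_in[OF th] t]])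
          (auto simp: l_def fob_act_nerve fmor_act_nerve compose_eq)
      then show ?thesis by simp
    qed
  qed
  moreover have "l m \<theta> = u m \<theta>" if t: "\<theta> \<in> simps (horn n k) m" for m \<theta>
  proof (rule nerve_eqI)
    have th: "\<theta> \<in> simp_op m n"
      using t by (simp add: simps_horn)
    show "l m \<theta> \<in> simps (nerve C) m" "u m \<theta> \<in> simps (nerve C) m"
      using l_in[OF th] smap_in[OF u t] by auto
    show "fob (l m \<theta>) a = fob (u m \<theta>) a" if "a \<le> m" for a
      using that th fob_smap_nerve[OF u t that] by (simp add: l_def V_def subsimplex_horn)
    show "fmor (l m \<theta>) (a, b, ()) = fmor (u m \<theta>) (a, b, ())" if ab: "a \<le> b" "b \<le> m" for a b
    proof -
      have "good [\<theta> a, \<theta> b]"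
        using t ab by (auto simp: simps_horn good_def)
      then have "F (\<theta> a) (\<theta> b) = U (\<theta> a) (\<theta> b)"
        using simp_op_bounds[OF th ab] by (intro F_good)
      then show ?thesis
        using ab th fmor_smap_nerve[OF u t ab] by (simp add: l_def U_def subsimplex_horn)
    qed
  qed
  ultimately show ?thesis ..
qed

theorem quasi_category_nerve: "category C \<Longrightarrow> quasi_category (nerve C)"
  unfolding quasi_category_iff using simplicial_set_nerve inner_horn_filler_nerve by metis


section \<open>Homotopies into a nerve\<close>

definition interval_simplex :: "nat list \<Rightarrow> (nat, unit, nat, unit) functor_data" where
  "interval_simplex xs = nerve_simplex (length xs - 1) ((!) xs) (\<lambda>i j. ())"

lemma interval_simplex_in:
  assumes "length xs = Suc n" "set xs \<subseteq> {0, 1}"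
  shows "interval_simplex xs \<in> simps interval n"
proof -
  have "xs ! i \<in> {0, 1}" if "i \<le> n" for i
    using assms that nth_mem[of i xs] by (metis le_imp_less_Suc subsetD)
  then have "nerve_simplex n ((!) xs) (\<lambda>i j. ()) \<in> simps (nerve iso_groupoid) n"
    by (intro nerve_simplex_in) (auto simp: iso_groupoid_def)
  then show ?thesis
    using assms(1) by (simp add: interval_def interval_simplex_def)
qed

lemma subsimplex_interval:
  assumes xs: "length xs = Suc n" "set xs \<subseteq> {0, 1}"
    and ys: "length ys = Suc m" "sorted ys" "set ys \<subseteq> {..n}"
  shows "subsimplex interval n ys (interval_simplex xs) = interval_simplex (map ((!) xs) ys)"
proof -
  note t = list_op_in_simp_op[OF ys]
  have x: "interval_simplex xs \<in> simps (nerve iso_groupoid) n"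
    using interval_simplex_in[OF xs] by (simp add: interval_def)
  have "set (map ((!) xs) ys) \<subseteq> {0, 1}"
  proof -
    have "xs ! i \<in> {0, 1}" if "i \<in> set ys" for i
      using that xs ys(3) nth_mem[of i xs] by (metis atMost_iff le_imp_less_Suc subsetD)
    then show ?thesis
      unfolding set_map by (rule image_subsetI)
  qed
  then have y: "interval_simplex (map ((!) xs) ys) \<in> simps (nerve iso_groupoid) m"
    using interval_simplex_in[of "map ((!) xs) ys" m] ys(1) by (simp add: interval_def)
  have "act (nerve iso_groupoid) m n (list_op ys) (interval_simplex xs) =
      interval_simplex (map ((!) xs) ys)"
  proof (rule nerve_eqI[OF act_nerve_in[OF x t] y])
    show "fob (act (nerve iso_groupoid) m n (list_op ys) (interval_simplex xs)) i =
        fob (interval_simplex (map ((!) xs) ys)) i" if "i \<le> m" for i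
      using that xs(1) ys(1) simp_op_bounds(2)[OF t _ that, of i]
      by (simp add: fob_act_nerve interval_simplex_def list_op_def)
  qed simp
  then show ?thesis
    using ys(1) by (simp add: subsimplex_def interval_def)
qed

lemma interval_vertex_eq:
  "interval_vertex a 0 = interval_simplex [a]" "interval_vertex a 1 = interval_simplex [a, a]"
  by (auto simp: interval_vertex_def interval_simplex_def nerve_simplex_def fun_eq_iff le_Suc_eq
      restrict_def)

lemma simps_sprod [simp]: "simps (sprod X Y) n = simps X n \<times> simps Y n"
  and act_sprod [simp]: "act (sprod X Y) m n \<theta> (x, y) = (act X m n \<theta> x, act Y m n \<theta> y)"
  by (simp_all add: sprod_def)

lemma subsimplex_sprod:
  "subsimplex (sprod X Y) n xs (x, y) = (subsimplex X n xs x, subsimplex Y n xs y)"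
  by (simp add: subsimplex_def)

text \<open>
  Natural isomorphism of the functors on the path category that two maps \<open>v\<close>, \<open>w\<close> into a nerve
  correspond to, tested on edges only.
\<close>

definition edgewise_iso :: "'a sset \<Rightarrow> ('o, 'm) cat \<Rightarrow> (nat \<Rightarrow> 'a \<Rightarrow> (nat, unit, 'o, 'm) functor_data)
    \<Rightarrow> (nat \<Rightarrow> 'a \<Rightarrow> (nat, unit, 'o, 'm) functor_data) \<Rightarrow> ('a \<Rightarrow> 'm) \<Rightarrow> bool" where
  "edgewise_iso X C v w \<eta> \<longleftrightarrow>
     (\<forall>x\<in>simps X 0. iso_in C (vertex_value v x) (vertex_value w x) (\<eta> x)) \<and>
     (\<forall>e\<in>simps X 1.
        cmp C (vertex_value v (src X e)) (vertex_value v (tgt X e)) (vertex_value w (tgt X e))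
          (\<eta> (tgt X e)) (edge_value v e) =
        cmp C (vertex_value v (src X e)) (vertex_value w (src X e)) (vertex_value w (tgt X e))
          (edge_value w e) (\<eta> (src X e)))"

text \<open>
  A homotopy \<open>h\<close> is evaluated on the edges \<open>(e, a \<rightarrow> b)\<close> of \<open>X \<times> I\<close>. The component at a vertex is the
  value at \<open>(s\<^sub>0 x, 0 \<rightarrow> 1)\<close>, inverted by the one at \<open>(s\<^sub>0 x, 1 \<rightarrow> 0)\<close>. The naturality square of an
  edge \<open>e\<close> consists of the triangles \<open>(s\<^sub>0 e, 0 \<rightarrow> 1 \<rightarrow> 1)\<close> and \<open>(s\<^sub>1 e, 0 \<rightarrow> 0 \<rightarrow> 1)\<close>, whose common
  side is \<open>(e, 0 \<rightarrow> 1)\<close>.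
\<close>

lemma edgewise_iso_homotopic:
  assumes X: "simplicial_set X" and hom: "I_homotopic X (nerve C) v w"
  shows "\<exists>\<eta>. edgewise_iso X C v w \<eta>"
proof -
  obtain h where h: "h \<in> smaps (sprod X interval) (nerve C)"
    and h0: "\<And>n x. x \<in> simps X n \<Longrightarrow> h n (x, interval_vertex 0 n) = v n x"
    and h1: "\<And>n x. x \<in> simps X n \<Longrightarrow> h n (x, interval_vertex 1 n) = w n x"
    using hom unfolding I_homotopic_def by blast
  define Ob where "Ob x a = vertex_value h (x, interval_simplex [a])" for x a
  define K where "K e a b = edge_value h (e, interval_simplex [a, b])" for e a b
  note diagram = path_diagram_smap[OF h, unfolded path_diagram_def]
  have K_hom: "K e a b \<in> hom C (Ob (src X e) a) (Ob (tgt X e) b)"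
    if "e \<in> simps X 1" "{a, b} \<subseteq> {0, 1}" for e a b
  proof -
    have "(e, interval_simplex [a, b]) \<in> simps (sprod X interval) 1"
      using that interval_simplex_in[of "[a, b]" 1] by simp
    then show ?thesis
      using diagram that(2) unfolding K_def Ob_def
      by (force simp: subsimplex_sprod subsimplex_interval)
  qed
  have K_id: "K (subsimplex X 0 [0, 0] x) a a = idt C (Ob x a)"
    if "x \<in> simps X 0" "a \<in> {0, 1}" for x a
  proof -
    have "(x, interval_simplex [a]) \<in> simps (sprod X interval) 0"
      using that interval_simplex_in[of "[a]" 0] by simp
    then show ?thesis
      using diagram that(2) unfolding K_def Ob_def
      by (force simp: subsimplex_sprod subsimplex_interval)
  qed
  have K_cmp: "K (subsimplex X 2 [0, 2] s) a c =
      cmp C (Ob (subsimplex X 2 [0] s) a) (Ob (subsimplex X 2 [1] s) b) (Ob (subsimplex X 2 [2] s) c)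
        (K (subsimplex X 2 [1, 2] s) b c) (K (subsimplex X 2 [0, 1] s) a b)"
    if "s \<in> simps X 2" "{a, b, c} \<subseteq> {0, 1}" for s a b c
  proof -
    let ?t = "interval_simplex [a, b, c]"
    have "(s, ?t) \<in> simps (sprod X interval) 2"
      using that interval_simplex_in[of "[a, b, c]" 2] by simp
    moreover have "subsimplex interval 2 ys ?t = interval_simplex (map ((!) [a, b, c]) ys)"
      if "length ys = Suc m" "sorted ys" "set ys \<subseteq> {..2}" for ys m
      using \<open>{a, b, c} \<subseteq> {0, 1}\<close> that by (intro subsimplex_interval) auto
    ultimately show ?thesis
      using diagram unfolding K_def Ob_def by (fastforce simp: subsimplex_sprod)
  qed
  have Ob_eq: "Ob x 0 = vertex_value v x" "Ob x 1 = vertex_value w x" if "x \<in> simps X 0" for x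
    using h0[OF that] h1[OF that] by (simp_all add: Ob_def vertex_value_def interval_vertex_eq)
  have K_eq: "K e 0 0 = edge_value v e" "K e 1 1 = edge_value w e" if "e \<in> simps X 1" for e
    using h0[OF that] h1[OF that]
    by (simp_all add: K_def edge_value_def interval_vertex_eq[simplified])
  define \<eta> where "\<eta> x = K (subsimplex X 0 [0, 0] x) 0 1" for x
  have "edgewise_iso X C v w \<eta>"
    unfolding edgewise_iso_def
  proof (intro conjI ballI)
    fix x
    assume x: "x \<in> simps X 0"
    let ?e = "subsimplex X 0 [0, 0] x" and ?s = "subsimplex X 0 [0, 0, 0] x"
    have e: "?e \<in> simps X 1" "src X ?e = x" "tgt X ?e = x"
      using X x by (simp_all add: subsimplex_in subsimplex_subsimplex subsimplex_vertex)
    have s: "?s \<in> simps X 2"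
      using X x by (intro subsimplex_in) auto
    have sub: "subsimplex X 2 ys ?s = subsimplex X 0 (map ((!) [0, 0, 0]) ys) x"
      if "ys \<noteq> []" "sorted ys" "set ys \<subseteq> {..2}" for ys
      using that by (intro subsimplex_subsimplex[OF X x]) auto
    have "cmp C (Ob x a) (Ob x b) (Ob x a) (K ?e b a) (K ?e a b) = idt C (Ob x a)"
      if "{a, b} \<subseteq> {0, 1}" for a b
      using K_cmp[OF s, of a b a] K_id[OF x, of a] that by (simp add: sub subsimplex_vertex[OF X x])
    then have "iso_in C (Ob x 0) (Ob x 1) (K ?e 0 1)"
      unfolding iso_in_def using K_hom[OF e(1), of 0 1] K_hom[OF e(1), of 1 0] e(2,3)
      by (intro conjI bexI[of _ "K ?e 1 0"]) auto
    then show "iso_in C (vertex_value v x) (vertex_value w x) (\<eta> x)"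
      using Ob_eq[OF x] by (simp add: \<eta>_def)
  next
    fix e
    assume e: "e \<in> simps X 1"
    have ends: "src X e \<in> simps X 0" "tgt X e \<in> simps X 0"
      using X e by (simp_all add: subsimplex_in)
    have sub: "subsimplex X 2 ys (subsimplex X 1 xs e) = subsimplex X 1 (map ((!) xs) ys) e"
      if "length xs = Suc 2" "sorted xs" "set xs \<subseteq> {..1}" "ys \<noteq> []" "sorted ys" "set ys \<subseteq> {..2}" for xs ys
      using that by (intro subsimplex_subsimplex[OF X e])
    have deg: "subsimplex X 1 [i, i] e = subsimplex X 0 [0, 0] (subsimplex X 1 [i] e)" if "i \<le> 1" for i
      using that e by (simp add: subsimplex_subsimplex[OF X])
    have s: "subsimplex X 1 [0, 0, 1] e \<in> simps X 2" "subsimplex X 1 [0, 1, 1] e \<in> simps X 2"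
      by (intro subsimplex_in[OF X e]; simp)+
    note edge = subsimplex_edge[OF X e]
    have "K e 0 1 = cmp C (Ob (src X e) 0) (Ob (src X e) 1) (Ob (tgt X e) 1) (K e 1 1) (\<eta> (src X e))"
      using K_cmp[OF s(1), of 0 1 1] edge deg[of 0]
      by (simp add: sub[unfolded One_nat_def] \<eta>_def)
    moreover have "K e 0 1 = cmp C (Ob (src X e) 0) (Ob (tgt X e) 0) (Ob (tgt X e) 1) (\<eta> (tgt X e)) (K e 0 0)"
      using K_cmp[OF s(2), of 0 0 1] edge deg[of 1]
      by (simp add: sub[unfolded One_nat_def] \<eta>_def)
    ultimately show "cmp C (vertex_value v (src X e)) (vertex_value v (tgt X e))
        (vertex_value w (tgt X e)) (\<eta> (tgt X e)) (edge_value v e) =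
      cmp C (vertex_value v (src X e)) (vertex_value w (src X e))
        (vertex_value w (tgt X e)) (edge_value w e) (\<eta> (src X e))"
      using Ob_eq ends K_eq[OF e] by simp
  qed
  then show ?thesis by blast
qed

lemma edgewise_iso_refl:
  assumes C: "category C" and v: "v \<in> smaps X (nerve C)" and X: "simplicial_set X"
  shows "edgewise_iso X C v v (\<lambda>x. idt C (vertex_value v x))"
proof -
  note d = path_diagram_smap[OF v]
  have "src X e \<in> simps X 0" "tgt X e \<in> simps X 0" if "e \<in> simps X 1" for e
    using X that by (simp_all add: subsimplex_in)
  then show ?thesis
    unfolding edgewise_iso_def
    using diagram_ob[OF X C d] diagram_hom[OF X C d]
    by (simp add: iso_in_id[OF C] cmp_id_left[OF C] cmp_id_right[OF C])
qed

lemma edgewise_iso_sym: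
  assumes C: "category C" and X: "simplicial_set X"
    and v: "v \<in> smaps X (nerve C)" and w: "w \<in> smaps X (nerve C)"
    and iso: "edgewise_iso X C v w \<eta>"
  shows "\<exists>\<eta>'. edgewise_iso X C w v \<eta>'"
proof -
  let ?v = "vertex_value v" and ?w = "vertex_value w"
  have "\<forall>x\<in>simps X 0. \<exists>r. \<eta> x \<in> hom C (?v x) (?w x) \<and> r \<in> hom C (?w x) (?v x) \<and>
      cmp C (?v x) (?w x) (?v x) r (\<eta> x) = idt C (?v x) \<and>
      cmp C (?w x) (?v x) (?w x) (\<eta> x) r = idt C (?w x)"
    using iso unfolding edgewise_iso_def iso_in_def by blast
  then obtain r where r: "\<And>x. x \<in> simps X 0 \<Longrightarrow> \<eta> x \<in> hom C (?v x) (?w x)"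
    "\<And>x. x \<in> simps X 0 \<Longrightarrow> r x \<in> hom C (?w x) (?v x)"
    "\<And>x. x \<in> simps X 0 \<Longrightarrow> cmp C (?v x) (?w x) (?v x) (r x) (\<eta> x) = idt C (?v x)"
    "\<And>x. x \<in> simps X 0 \<Longrightarrow> cmp C (?w x) (?v x) (?w x) (\<eta> x) (r x) = idt C (?w x)"
    by metis
  note dv = path_diagram_smap[OF v] and dw = path_diagram_smap[OF w]
  have "edgewise_iso X C w v r"
    unfolding edgewise_iso_def
  proof (intro conjI ballI)
    show "iso_in C (?w x) (?v x) (r x)" if "x \<in> simps X 0" for x
      unfolding iso_in_def using r[OF that] by blast
    fix e
    assume e: "e \<in> simps X 1"
    have ends: "src X e \<in> simps X 0" "tgt X e \<in> simps X 0"
      using X e by (simp_all add: subsimplex_in)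
    have sq: "cmp C (?v (src X e)) (?v (tgt X e)) (?w (tgt X e)) (\<eta> (tgt X e)) (edge_value v e) =
        cmp C (?v (src X e)) (?w (src X e)) (?w (tgt X e)) (edge_value w e) (\<eta> (src X e))"
      using iso e unfolding edgewise_iso_def by blast
    show "cmp C (?w (src X e)) (?w (tgt X e)) (?v (tgt X e)) (r (tgt X e)) (edge_value w e) =
        cmp C (?w (src X e)) (?v (src X e)) (?v (tgt X e)) (edge_value v e) (r (src X e))"
      by (rule iso_square_inverse[OF C _ _ _ _ diagram_hom[OF X C dv e] diagram_hom[OF X C dw e]
            r(1)[OF ends(1)] r(2)[OF ends(1)] r(4)[OF ends(1)]
            r(1)[OF ends(2)] r(2)[OF ends(2)] r(3)[OF ends(2)] sq])
        (use ends diagram_ob[OF X C dv] diagram_ob[OF X C dw] in auto)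
  qed
  then show ?thesis by blast
qed

lemma edgewise_iso_trans:
  assumes C: "category C" and X: "simplicial_set X"
    and u: "u \<in> smaps X (nerve C)" and v: "v \<in> smaps X (nerve C)" and w: "w \<in> smaps X (nerve C)"
    and uv: "edgewise_iso X C u v \<eta>" and vw: "edgewise_iso X C v w \<zeta>"
  shows "\<exists>\<xi>. edgewise_iso X C u w \<xi>"
proof -
  let ?u = "vertex_value u" and ?v = "vertex_value v" and ?w = "vertex_value w"
  note du = path_diagram_smap[OF u] and dv = path_diagram_smap[OF v] and dw = path_diagram_smap[OF w]
  note ob = diagram_ob[OF X C du] diagram_ob[OF X C dv] diagram_ob[OF X C dw]
  have iso: "iso_in C (?u x) (?v x) (\<eta> x)" "iso_in C (?v x) (?w x) (\<zeta> x)" if "x \<in> simps X 0" for x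
    using uv vw that unfolding edgewise_iso_def by auto
  have "edgewise_iso X C u w (\<lambda>x. cmp C (?u x) (?v x) (?w x) (\<zeta> x) (\<eta> x))"
    unfolding edgewise_iso_def
  proof (intro conjI ballI)
    show "iso_in C (?u x) (?w x) (cmp C (?u x) (?v x) (?w x) (\<zeta> x) (\<eta> x))"
      if "x \<in> simps X 0" for x
      using that iso ob by (intro iso_in_cmp[OF C])
    fix e
    assume e: "e \<in> simps X 1"
    have ends: "src X e \<in> simps X 0" "tgt X e \<in> simps X 0"
      using X e by (simp_all add: subsimplex_in)
    let ?s = "src X e" and ?t = "tgt X e"
    show "cmp C (?u ?s) (?u ?t) (?w ?t) (cmp C (?u ?t) (?v ?t) (?w ?t) (\<zeta> ?t) (\<eta> ?t)) (edge_value u e) =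
        cmp C (?u ?s) (?w ?s) (?w ?t) (edge_value w e) (cmp C (?u ?s) (?v ?s) (?w ?s) (\<zeta> ?s) (\<eta> ?s))"
      by (rule iso_square_paste[OF C, where g = "edge_value v e"])
        (use e ends ob iso uv vw diagram_hom[OF X C du] diagram_hom[OF X C dv] diagram_hom[OF X C dw]
          in \<open>auto simp: edgewise_iso_def iso_in_def\<close>)
  qed
  then show ?thesis by blast
qed

lemma edgewise_iso_equivclp:
  assumes C: "category C" and X: "simplicial_set X" and v: "v \<in> smaps X (nerve C)"
    and vw: "equivclp (I_homotopic X (nerve C)) v w"
  shows "\<exists>\<eta>. edgewise_iso X C v w \<eta>"
proof -
  have "w \<in> smaps X (nerve C) \<and> (\<exists>\<eta>. edgewise_iso X C v w \<eta>)"
    using vw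
  proof (induction rule: equivclp_induct)
    case base
    then show ?case using edgewise_iso_refl[OF C v X] v by blast
  next
    case (step y z)
    have z: "z \<in> smaps X (nerve C)" and y: "y \<in> smaps X (nerve C)"
      using step(2) unfolding I_homotopic_def by blast+
    have "\<exists>\<eta>. edgewise_iso X C y z \<eta>"
      using step(2) edgewise_iso_homotopic[OF X] edgewise_iso_sym[OF C X z y] by blast
    then show ?case
      using step(3) edgewise_iso_trans[OF C X v y z] z by blast
  qed
  then show ?thesis by blast
qed


section \<open>Homotopy classes and change of the target\<close>

lemma simplicial_set_sprod:
  "simplicial_set X \<Longrightarrow> simplicial_set Y \<Longrightarrow> simplicial_set (sprod X Y)"
  by (simp add: simplicial_set_def Pi_iff split_paired_all)

lemma interval_vertex_in: "a \<in> {0, 1} \<Longrightarrow> interval_vertex a n \<in> simps interval n"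
  using nerve_simplex_in[of n "\<lambda>i. a" iso_groupoid "\<lambda>i j. ()"]
  by (auto simp: interval_def interval_vertex_def nerve_simplex_def iso_groupoid_def restrict_def)

lemma I_homotopic_postcomp:
  assumes K: "simplicial_set K" and p: "p \<in> smaps Z W" and fg: "I_homotopic K Z f g"
  shows "I_homotopic K W (smap_comp K p f) (smap_comp K p g)"
proof -
  obtain h where h: "f \<in> smaps K Z" "g \<in> smaps K Z" "h \<in> smaps (sprod K interval) Z"
    "\<And>n x. x \<in> simps K n \<Longrightarrow> h n (x, interval_vertex 0 n) = f n x \<and> h n (x, interval_vertex 1 n) = g n x"
    using fg unfolding I_homotopic_def by blast
  have "smap_comp (sprod K interval) p h \<in> smaps (sprod K interval) W"
    using K h(3) p unfolding interval_def
    by (intro smap_comp_in simplicial_set_sprod simplicial_set_nerve)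
  then show ?thesis
    unfolding I_homotopic_def using h smap_comp_in[OF K _ p] interval_vertex_in
    by (intro conjI bexI[of _ "smap_comp (sprod K interval) p h"]) (auto simp: smap_comp_apply)
qed

lemma I_homotopic_precomp:
  assumes K: "simplicial_set K" and p: "p \<in> smaps K L" and fg: "I_homotopic L Z f g"
  shows "I_homotopic K Z (smap_comp K f p) (smap_comp K g p)"
proof -
  obtain h where h: "f \<in> smaps L Z" "g \<in> smaps L Z" "h \<in> smaps (sprod L interval) Z"
    "\<And>n x. x \<in> simps L n \<Longrightarrow> h n (x, interval_vertex 0 n) = f n x \<and> h n (x, interval_vertex 1 n) = g n x"
    using fg unfolding I_homotopic_def by blast
  define q where "q n = (\<lambda>(x, t)\<in>simps (sprod K interval) n. (p n x, t))" for n
  have KI: "simplicial_set (sprod K interval)"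
    using K unfolding interval_def by (intro simplicial_set_sprod simplicial_set_nerve)
  have "q \<in> smaps (sprod K interval) (sprod L interval)"
  proof (rule smapsI)
    fix m n \<theta> s
    assume t: "\<theta> \<in> simp_op m n" and s: "s \<in> simps (sprod K interval) n"
    then show "q m (act (sprod K interval) m n \<theta> s) = act (sprod L interval) m n \<theta> (q n s)"
      using simplicial_set_act[OF KI t s] by (cases s) (auto simp: q_def smap_act[OF p])
  qed (auto simp: q_def smap_in[OF p])
  then have "smap_comp (sprod K interval) h q \<in> smaps (sprod K interval) Z"
    using KI h(3) by (intro smap_comp_in)
  then show ?thesis
    unfolding I_homotopic_def using h smap_comp_in[OF K p] interval_vertex_in smap_in[OF p]
    by (intro conjI bexI[of _ "smap_comp (sprod K interval) h q"]) (auto simp: smap_comp_apply q_def)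
qed

lemma equivclp_map:
  assumes "equivclp r x y" "\<And>x y. r x y \<Longrightarrow> s (f x) (f y)"
  shows "equivclp s (f x) (f y)"
  using assms(1)
proof (induction rule: equivclp_induct)
  case (step y z)
  then show ?case using assms(2) equivclp_into_equivclp by metis
qed simp

definition homotopic :: "'a sset \<Rightarrow> 'b sset \<Rightarrow> (nat \<Rightarrow> 'a \<Rightarrow> 'b) \<Rightarrow> (nat \<Rightarrow> 'a \<Rightarrow> 'b) \<Rightarrow> bool" where
  "homotopic K Z = equivclp (I_homotopic K Z)"

lemma homotopic_postcomp:
  "simplicial_set K \<Longrightarrow> p \<in> smaps Z W \<Longrightarrow> homotopic K Z f g \<Longrightarrow>
    homotopic K W (smap_comp K p f) (smap_comp K p g)"
  unfolding homotopic_def by (erule equivclp_map) (rule I_homotopic_postcomp)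

lemma homotopic_precomp:
  "simplicial_set K \<Longrightarrow> p \<in> smaps K L \<Longrightarrow> homotopic L Z f g \<Longrightarrow>
    homotopic K Z (smap_comp K f p) (smap_comp K g p)"
  unfolding homotopic_def by (erule equivclp_map) (rule I_homotopic_precomp)

text \<open>
  Bijectivity of \<open>f\<^sup>*\<close> in terms of representatives, as two properties of \<open>Z\<close> that are easy to
  transport.
\<close>

definition restriction_bijective :: "'a sset \<Rightarrow> 'b sset \<Rightarrow> 'c sset \<Rightarrow> (nat \<Rightarrow> 'a \<Rightarrow> 'b) \<Rightarrow> bool" where
  "restriction_bijective X Y Z f \<longleftrightarrow>
     (\<forall>w\<in>smaps X Z. \<exists>u\<in>smaps Y Z. homotopic X Z (smap_comp X u f) w) \<and>
     (\<forall>u\<in>smaps Y Z. \<forall>u'\<in>smaps Y Z.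
        homotopic X Z (smap_comp X u f) (smap_comp X u' f) \<longrightarrow> homotopic Y Z u u')"

lemma equiv_I_homotopy_rel: "equiv (smaps K Z) (I_homotopy_rel K Z)"
  unfolding I_homotopy_rel_def
  by (rule equivI) (auto simp: refl_on_def intro!: symI transI intro: equivclp_sym equivclp_trans)

lemma restriction_bijective_if_bij:
  assumes X: "simplicial_set X" and f: "f \<in> smaps X Y"
    and bij: "bij_betw (pi_I_pullback X Z f) (pi_I Y Z) (pi_I X Z)"
  shows "restriction_bijective X Y Z f"
proof -
  let ?R = "I_homotopy_rel"
  note eqv = equiv_I_homotopy_rel
  have uf: "smap_comp X u f \<in> smaps X Z" if "u \<in> smaps Y Z" for u
    by (rule smap_comp_in[OF X f that])
  have rel: "(u, u') \<in> ?R K Z \<longleftrightarrow> u \<in> smaps K Z \<and> u' \<in> smaps K Z \<and> homotopic K Z u u'"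
    for K :: "'d sset" and u u'
    by (simp add: I_homotopy_rel_def homotopic_def)
  have pullback: "pi_I_pullback X Z f (?R Y Z `` {u}) = ?R X Z `` {smap_comp X u f}"
    if u: "u \<in> smaps Y Z" for u
  proof -
    have "?R X Z `` {smap_comp X u' f} = ?R X Z `` {smap_comp X u f}" if "u' \<in> ?R Y Z `` {u}" for u'
    proof -
      have "homotopic X Z (smap_comp X u f) (smap_comp X u' f)" "u' \<in> smaps Y Z"
        using that homotopic_precomp[OF X f] by (auto simp: rel)
      then have "(smap_comp X u f, smap_comp X u' f) \<in> ?R X Z"
        using uf u by (simp add: rel)
      then show ?thesis
        using equiv_class_eq[OF eqv] by blast
    qed
    moreover have "u \<in> ?R Y Z `` {u}"
      using equiv_class_self[OF eqv u] .
    ultimately show ?thesis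
      unfolding pi_I_pullback_def by blast
  qed
  have "\<exists>u\<in>smaps Y Z. homotopic X Z (smap_comp X u f) w" if w: "w \<in> smaps X Z" for w
  proof -
    have "?R X Z `` {w} \<in> pi_I_pullback X Z f ` pi_I Y Z"
      using bij w unfolding bij_betw_def pi_I_def by (simp add: quotientI)
    then obtain u where "u \<in> smaps Y Z" "?R X Z `` {w} = pi_I_pullback X Z f (?R Y Z `` {u})"
      unfolding pi_I_def quotient_def by blast
    moreover from this have "w \<in> ?R X Z `` {smap_comp X u f}"
      using equiv_class_self[OF eqv w] pullback by simp
    ultimately show ?thesis
      by (auto simp: rel)
  qed
  moreover have "homotopic Y Z u u'"
    if u: "u \<in> smaps Y Z" and u': "u' \<in> smaps Y Z"
      and h: "homotopic X Z (smap_comp X u f) (smap_comp X u' f)" for u u'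
  proof -
    have "(smap_comp X u f, smap_comp X u' f) \<in> ?R X Z"
      using uf u u' h by (simp add: rel)
    then have "pi_I_pullback X Z f (?R Y Z `` {u}) = pi_I_pullback X Z f (?R Y Z `` {u'})"
      using pullback u u' equiv_class_eq[OF eqv] by metis
    moreover have "inj_on (pi_I_pullback X Z f) (smaps Y Z // ?R Y Z)"
      using bij unfolding bij_betw_def pi_I_def by blast
    ultimately have "?R Y Z `` {u} = ?R Y Z `` {u'}"
      using u u' by (meson inj_onD quotientI)
    then have "(u, u') \<in> ?R Y Z"
      using eq_equiv_class[OF _ eqv u'] by blast
    then show ?thesis by (simp add: rel)
  qed
  ultimately show ?thesis
    unfolding restriction_bijective_def by blast
qed

text \<open>
  Being a quasi-category and the bijectivity of restriction both pass to retracts: a lifting or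
  extension problem is sent into the larger object, solved there, and retracted.
\<close>

lemma quasi_category_retract:
  assumes Z: "quasi_category Z" and W: "simplicial_set W"
    and i: "i \<in> smaps Z W" and j: "j \<in> smaps W Z"
    and ij: "\<And>n x. x \<in> simps W n \<Longrightarrow> i n (j n x) = x"
  shows "quasi_category W"
  unfolding quasi_category_iff
proof (intro conjI allI impI ballI)
  fix n k u
  assume k: "0 < k \<and> k < n" and u: "u \<in> smaps (horn n k) W"
  have "\<forall>u\<in>smaps (horn n k) Z. \<exists>l\<in>smaps (std_simplex n) Z.
      \<forall>m. \<forall>\<theta>\<in>simps (horn n k) m. l m \<theta> = u m \<theta>"
    using Z k unfolding quasi_category_iff by blast
  from bspec[OF this smap_comp_in[OF simplicial_set_horn u j]]
  obtain l where l: "l \<in> smaps (std_simplex n) Z"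
    "\<And>m \<theta>. \<theta> \<in> simps (horn n k) m \<Longrightarrow> l m \<theta> = smap_comp (horn n k) j u m \<theta>"
    by blast
  have "smap_comp (std_simplex n) i l m \<theta> = u m \<theta>" if "\<theta> \<in> simps (horn n k) m" for m \<theta>
    using that l(2)[OF that] ij smap_in[OF u that] by (simp add: smap_comp_apply simps_horn)
  then show "\<exists>l\<in>smaps (std_simplex n) W. \<forall>m. \<forall>\<theta>\<in>simps (horn n k) m. l m \<theta> = u m \<theta>"
    using smap_comp_in[OF simplicial_set_std_simplex l(1) i] by blast
qed (rule W)

lemma restriction_bijective_retract:
  assumes X: "simplicial_set X" and Y: "simplicial_set Y" and f: "f \<in> smaps X Y"
    and W: "restriction_bijective X Y W f"
    and i: "i \<in> smaps Z W" and j: "j \<in> smaps W Z"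
    and ji: "\<And>n x. x \<in> simps Z n \<Longrightarrow> j n (i n x) = x"
  shows "restriction_bijective X Y Z f"
proof -
  have jiX: "smap_comp X j (smap_comp X i w) = w" if w: "w \<in> smaps X Z" for w
    using smap_in[OF w]
    by (intro smap_eqI[OF smap_comp_in[OF X smap_comp_in[OF X w i] j] w]) (simp add: smap_comp_apply ji)
  have jiY: "smap_comp Y j (smap_comp Y i w) = w" if w: "w \<in> smaps Y Z" for w
    using smap_in[OF w]
    by (intro smap_eqI[OF smap_comp_in[OF Y smap_comp_in[OF Y w i] j] w]) (simp add: smap_comp_apply ji)
  have "\<exists>u\<in>smaps Y Z. homotopic X Z (smap_comp X u f) w" if w: "w \<in> smaps X Z" for w
  proof -
    obtain u where u: "u \<in> smaps Y W" "homotopic X W (smap_comp X u f) (smap_comp X i w)"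
      using W smap_comp_in[OF X w i] unfolding restriction_bijective_def by blast
    have "homotopic X Z (smap_comp X (smap_comp Y j u) f) w"
      using homotopic_postcomp[OF X j u(2)] by (simp add: jiX[OF w] smap_comp_assoc[OF f])
    then show ?thesis
      using smap_comp_in[OF Y u(1) j] by blast
  qed
  moreover have "homotopic Y Z u u'"
    if u: "u \<in> smaps Y Z" and u': "u' \<in> smaps Y Z"
      and h: "homotopic X Z (smap_comp X u f) (smap_comp X u' f)" for u u'
  proof -
    have "homotopic X W (smap_comp X (smap_comp Y i u) f) (smap_comp X (smap_comp Y i u') f)"
      using homotopic_postcomp[OF X i h] by (simp add: smap_comp_assoc[OF f])
    then have "homotopic Y W (smap_comp Y i u) (smap_comp Y i u')"
      using W smap_comp_in[OF Y u i] smap_comp_in[OF Y u' i] unfolding restriction_bijective_def by blast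
    then show ?thesis
      using homotopic_postcomp[OF Y j] jiY[OF u] jiY[OF u'] by metis
  qed
  ultimately show ?thesis
    unfolding restriction_bijective_def by blast
qed

text \<open>Transport of a simplicial structure along bijections that may differ from degree to degree.\<close>

definition relabel :: "(nat \<Rightarrow> 'a \<Rightarrow> 'b) \<Rightarrow> 'a sset \<Rightarrow> 'b sset" where
  "relabel \<phi> Z = \<lparr>simps = (\<lambda>n. \<phi> n ` simps Z n),
     act = (\<lambda>m n \<theta> x. \<phi> m (act Z m n \<theta> (inv_into (simps Z n) (\<phi> n) x)))\<rparr>"

lemma relabel_iso:
  assumes Z: "simplicial_set Z" and inj: "\<And>n. inj_on (\<phi> n) (simps Z n)"
  shows "simplicial_set (relabel \<phi> Z)"
    and "(\<lambda>n. restrict (\<phi> n) (simps Z n)) \<in> smaps Z (relabel \<phi> Z)"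
    and "(\<lambda>n. restrict (inv_into (simps Z n) (\<phi> n)) (\<phi> n ` simps Z n)) \<in> smaps (relabel \<phi> Z) Z"
proof -
  have act: "act (relabel \<phi> Z) m n \<theta> (\<phi> n x) = \<phi> m (act Z m n \<theta> x)" if "x \<in> simps Z n" for m n \<theta> x
    using that inj by (simp add: relabel_def)
  have simps: "simps (relabel \<phi> Z) n = \<phi> n ` simps Z n" for n
    by (simp add: relabel_def)
  note in_Z = simplicial_set_act[OF Z]
  have "act Z n n (\<lambda>i\<in>{..n}. i) x = x" if "x \<in> simps Z n" for n x
    using Z that unfolding simplicial_set_def by blast
  then show "simplicial_set (relabel \<phi> Z)"
    using simplicial_set_comp[OF Z] in_Z unfolding simplicial_set_def
    by (auto simp: simps act)
  show "(\<lambda>n. restrict (\<phi> n) (simps Z n)) \<in> smaps Z (relabel \<phi> Z)"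
    by (rule smapsI) (auto simp: simps act in_Z)
  show "(\<lambda>n. restrict (inv_into (simps Z n) (\<phi> n)) (\<phi> n ` simps Z n)) \<in> smaps (relabel \<phi> Z) Z"
    by (rule smapsI) (auto simp: simps act in_Z inj inj_on_eq_iff[OF inj])
qed

text \<open>
  The test objects of a weak equivalence thus include all quasi-categories that are small enough,
  whatever the type of their simplices: relabelling produces an isomorphic copy in \<open>'u\<close>.
\<close>

lemma restriction_bijective_if_embeddable:
  fixes X Y :: "'u::infinite sset" and Z :: "'z sset" and \<phi> :: "nat \<Rightarrow> 'z \<Rightarrow> 'u"
  assumes X: "simplicial_set X" and Y: "simplicial_set Y" and f: "f \<in> smaps X Y"
    and weq: "categorical_weak_equivalence X Y f"
    and Z: "quasi_category Z" and inj: "\<And>n. inj_on (\<phi> n) (simps Z n)"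
  shows "restriction_bijective X Y Z f"
proof (rule restriction_bijective_retract[OF X Y f])
  have "simplicial_set Z"
    using Z unfolding quasi_category_def by blast
  note iso = relabel_iso[OF this inj]
  show "(\<lambda>n. restrict (\<phi> n) (simps Z n)) \<in> smaps Z (relabel \<phi> Z)"
    and "(\<lambda>n. restrict (inv_into (simps Z n) (\<phi> n)) (\<phi> n ` simps Z n)) \<in> smaps (relabel \<phi> Z) Z"
    by (rule iso)+
  have "quasi_category (relabel \<phi> Z)"
    by (rule quasi_category_retract[OF Z iso]) (auto simp: relabel_def inj)
  then show "restriction_bijective X Y (relabel \<phi> Z) f"
    using weq restriction_bijective_if_bij[OF X f] unfolding categorical_weak_equivalence_def by blast
  show "restrict (inv_into (simps Z n) (\<phi> n)) (\<phi> n ` simps Z n) (restrict (\<phi> n) (simps Z n) x) = x"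
    if "x \<in> simps Z n" for n x
    using that inj by simp
qed


section \<open>The nerve of the path category is small\<close>

lemma inj_pair: "\<exists>p :: 'u::infinite \<times> 'u \<Rightarrow> 'u. inj p"
proof -
  have "\<exists>p. inj_on p (UNIV \<times> UNIV :: ('u \<times> 'u) set) \<and> p ` (UNIV \<times> UNIV) \<subseteq> (UNIV :: 'u set)"
    using ordIso_imp_ordLeq[OF card_of_Times_same_infinite[OF infinite_UNIV]]
    unfolding card_of_ordLeq .
  then show ?thesis by auto
qed

lemma inj_list: "\<exists>c :: 'u::infinite list \<Rightarrow> 'u. inj c"
proof -
  obtain p :: "'u \<times> 'u \<Rightarrow> 'u" where p: "inj p"
    using inj_pair by blast
  obtain q :: "nat \<Rightarrow> 'u" where q: "inj q"
    using infinite_countable_subset[OF infinite_UNIV] by blast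
  \<comment> \<open>Nested pairs code lists of a fixed length injectively, so the length is recorded as well.\<close>
  define r where "r xs = foldr (\<lambda>a b. p (a, b)) xs (q 0)" for xs
  have r: "length xs = length ys \<Longrightarrow> r xs = r ys \<Longrightarrow> xs = ys" for xs ys
    by (induction xs ys rule: list_induct2) (auto simp: r_def dest: injD[OF p])
  have "inj (\<lambda>xs. p (q (length xs), r xs))"
    by (rule injI) (auto dest!: injD[OF p] injD[OF q] intro: r)
  then show ?thesis by blast
qed

text \<open>
  A simplex of the nerve is coded by its vertices together with one path for each of its edges.
  Since the vertices fix the hom-sets, the chosen paths determine the morphisms.
\<close>

lemma nerve_path_category_embeddable:
  fixes X :: "'u::infinite sset"
  assumes X: "simplicial_set X"
  shows "\<exists>\<phi> :: nat \<Rightarrow> _ \<Rightarrow> 'u. \<forall>n. inj_on (\<phi> n) (simps (nerve (path_category X)) n)"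
proof -
  obtain c :: "'u list \<Rightarrow> 'u" where c: "inj c"
    using inj_list by blast
  define pairs where "pairs n = filter (\<lambda>(i, j). i \<le> j) (List.product [0..<Suc n] [0..<Suc n])" for n
  have set_pairs: "set (pairs n) = {(i, j). i \<le> j \<and> j \<le> n}" for n
    by (auto simp: pairs_def)
  define path where "path S = (\<lambda>(i, j). SOME p. p \<in> fmor S (i, j, ()))"
    for S :: "(nat, unit, 'u, 'u list set) functor_data"
  define \<phi> where "\<phi> n S = c (c (map (fob S) [0..<Suc n]) # map (\<lambda>ij. c (path S ij)) (pairs n))"
    for n and S :: "(nat, unit, 'u, 'u list set) functor_data"
  have "inj_on (\<phi> n) (simps (nerve (path_category X)) n)" for n
  proof (rule inj_onI)
    fix S T
    assume S: "S \<in> simps (nerve (path_category X)) n" and T: "T \<in> simps (nerve (path_category X)) n"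
      and eq: "\<phi> n S = \<phi> n T"
    have "map (fob S) [0..<Suc n] = map (fob T) [0..<Suc n]"
      and "map (\<lambda>ij. c (path S ij)) (pairs n) = map (\<lambda>ij. c (path T ij)) (pairs n)"
      using eq unfolding \<phi>_def by (auto dest!: injD[OF c])
    then have ob: "\<And>i. i \<le> n \<Longrightarrow> fob S i = fob T i"
      and path: "\<And>i j. i \<le> j \<Longrightarrow> j \<le> n \<Longrightarrow> path S (i, j) = path T (i, j)"
      by (auto simp: set_pairs inj_eq[OF c] simp del: upt_Suc)
    have path_mem: "path R (i, j) \<in> fmor R (i, j, ())"
      if "R \<in> simps (nerve (path_category X)) n" "i \<le> j" "j \<le> n" for R i j
    proof -
      have "\<exists>p. p \<in> fmor R (i, j, ())"
        using nerve_hom[OF that] path_class_self by fastforce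
      then show ?thesis
        unfolding path_def by (simp add: some_in_eq ex_in_conv)
    qed
    show "S = T"
    proof (rule nerve_eqI[OF S T ob])
      fix i j
      assume ij: "i \<le> j" "j \<le> n"
      then show "fmor S (i, j, ()) = fmor T (i, j, ())"
        using nerve_hom[OF S ij] nerve_hom[OF T ij] path_mem[OF S ij] path_mem[OF T ij] ob path[OF ij]
        by (intro path_hom_eqI[OF X]) auto
    qed
  qed
  then show ?thesis by blast
qed

section \<open>Categorical weak equivalences induce equivalences of path categories\<close>

lemma path_extension_edge:
  assumes X: "simplicial_set X" and C: "category C" and VM: "path_diagram X C V M"
    and e: "e \<in> simps X 1"
  shows "fmor (path_extension X C V M) (src X e, tgt X e, path_class X (src X e) (tgt X e) [e]) = M e"
  using path_extension_class[OF X C VM edge_path_edge[OF X e]] path_value_edge[OF X C VM e] by simp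

theorem lemma28:
  fixes X Y :: "'u::infinite sset" and g :: "nat \<Rightarrow> 'u \<Rightarrow> 'u"
  assumes "simplicial_set X" and "simplicial_set Y"
    and "g \<in> smaps X Y"
    and "categorical_weak_equivalence X Y g"
  shows "equivalence_of_categories (path_category X) (path_category Y) (path_functor X Y g)"
proof -
  note X = assms(1) and Y = assms(2) and g = assms(3)
  let ?PX = "path_category X" and ?PY = "path_category Y" and ?F = "path_functor X Y g"
  note PX = category_path_category[OF X] and PY = category_path_category[OF Y]
  note F = path_functor_in[OF X Y g]
  have bij: "restriction_bijective X Y (nerve (path_category W)) g"
    if W: "simplicial_set W" for W :: "'u sset"
    using nerve_path_category_embeddable[OF W] quasi_category_nerve[OF category_path_category[OF W]]
      restriction_bijective_if_embeddable[OF assms] by blast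

  obtain u where u: "u \<in> smaps Y (nerve ?PX)"
    and gu: "homotopic X (nerve ?PX) (smap_comp X u g) (path_unit X)"
    using bij[OF X] path_unit_in[OF X] unfolding restriction_bijective_def by blast
  define G where "G = path_extension Y ?PX (vertex_value u) (edge_value u)"
  note du = path_diagram_smap[OF u]
  have G: "G \<in> functors ?PY ?PX"
    unfolding G_def by (rule path_extension_in[OF Y PX du])
  have G_ob: "fob G y = vertex_value u y" if "y \<in> simps Y 0" for y
    using that by (simp add: G_def path_extension_def)
  have G_edge: "fmor G (src Y e, tgt Y e, path_class Y (src Y e) (tgt Y e) [e]) = edge_value u e"
    if "e \<in> simps Y 1" for e
    unfolding G_def by (rule path_extension_edge[OF Y PX du that])
  have F_ob: "fob ?F x = g 0 x" if "x \<in> simps X 0" for x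
    using that by (simp add: path_functor_def)
  have F_edge: "fmor ?F (src X e, tgt X e, path_class X (src X e) (tgt X e) [e]) =
      path_class Y (src Y (g 1 e)) (tgt Y (g 1 e)) [g 1 e]" if "e \<in> simps X 1" for e
    using path_functor_class[OF X Y g edge_path_edge[OF X that]] smap_src_tgt[OF g that] by simp
  have ends: "src W e \<in> simps W 0" "tgt W e \<in> simps W 0"
    if "simplicial_set W" "e \<in> simps W 1" for W :: "'u sset" and e
    using that by (simp_all add: subsimplex_in)
  have arrow: "path_class W (src W e) (tgt W e) [e] \<in> hom (path_category W) (src W e) (tgt W e)"
    if "simplicial_set W" "e \<in> simps W 1" for W :: "'u sset" and e
    using edge_path_edge[OF that] by (simp only: path_category_simps) blast

  have "smap_comp X u g \<in> smaps X (nerve ?PX)"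
    by (rule smap_comp_in[OF X g u])
  \<comment> \<open>The unit corresponds to the identity functor and \<open>u g\<close> to \<open>G g\<^sub>*\<close>.\<close>
  then obtain \<eta> where \<eta>: "edgewise_iso X ?PX (path_unit X) (smap_comp X u g) \<eta>"
    using edgewise_iso_equivclp[OF PX X path_unit_in[OF X] equivclp_sym] gu
    unfolding homotopic_def by blast
  have ug: "vertex_value (smap_comp X u g) x = vertex_value u (g 0 x)" if "x \<in> simps X 0" for x
    using that by (simp add: vertex_value_def smap_comp_apply)
  have ug': "edge_value (smap_comp X u g) e = edge_value u (g 1 e)" if "e \<in> simps X 1" for e
    using that by (simp add: edge_value_def smap_comp_apply)
  have "natural_iso ?PX ?PX (id_functor ?PX) (comp_functor ?PX G ?F) \<eta>"
  proof (rule natural_iso_path_categoryI[OF X PX id_functor_in[OF PX] comp_functor_in[OF PX F G]])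
    have id_ob: "fob (id_functor ?PX) x = vertex_value (path_unit X) x"
      and GF_ob: "fob (comp_functor ?PX G ?F) x = vertex_value (smap_comp X u g) x"
      if "x \<in> simps X 0" for x
      using that smap_in[OF g that]
      by (simp_all add: id_functor_def comp_functor_def compose_def F_ob G_ob ug vertex_value_unit[OF X])
    show "iso_in ?PX (fob (id_functor ?PX) x) (fob (comp_functor ?PX G ?F) x) (\<eta> x)"
      if "x \<in> simps X 0" for x
      using \<eta> that unfolding edgewise_iso_def by (simp add: id_ob GF_ob)
    fix e
    assume e: "e \<in> simps X 1"
    let ?e = "path_class X (src X e) (tgt X e) [e]"
    have "(src X e, tgt X e, ?e) \<in> arrows ?PX"
      using ends[OF X e] arrow[OF X e] by simp
    then have "fmor (id_functor ?PX) (src X e, tgt X e, ?e) = edge_value (path_unit X) e"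
      and "fmor (comp_functor ?PX G ?F) (src X e, tgt X e, ?e) = edge_value (smap_comp X u g) e"
      using F_edge[OF e] G_edge[OF smap_in[OF g e]] smap_src_tgt[OF g e] F_ob ends[OF X e]
      by (simp_all add: id_functor_def comp_functor_def edge_value_unit[OF X e] ug'[OF e])
    then show "cmp ?PX (fob (id_functor ?PX) (src X e)) (fob (id_functor ?PX) (tgt X e))
          (fob (comp_functor ?PX G ?F) (tgt X e)) (\<eta> (tgt X e))
          (fmor (id_functor ?PX) (src X e, tgt X e, ?e)) =
        cmp ?PX (fob (id_functor ?PX) (src X e)) (fob (comp_functor ?PX G ?F) (src X e))
          (fob (comp_functor ?PX G ?F) (tgt X e))
          (fmor (comp_functor ?PX G ?F) (src X e, tgt X e, ?e)) (\<eta> (src X e))"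
      using \<eta> e ends[OF X e] unfolding edgewise_iso_def by (simp only: id_ob GF_ob)
  qed
  moreover

  let ?w = "smap_comp Y (nerve_map ?PX ?F) u"
  have w: "?w \<in> smaps Y (nerve ?PY)"
    by (rule smap_comp_in[OF Y u nerve_map_in[OF F]])
  have "homotopic X (nerve ?PY) (smap_comp X ?w g) (smap_comp X (path_unit Y) g)"
    using homotopic_postcomp[OF X nerve_map_in[OF F] gu]
    by (simp add: smap_comp_assoc[OF g] path_unit_natural[OF X Y g])
  then have "homotopic Y (nerve ?PY) ?w (path_unit Y)"
    using bij[OF Y] w path_unit_in[OF Y] unfolding restriction_bijective_def by blast
  \<comment> \<open>Likewise \<open>N(g\<^sub>*) u\<close> corresponds to \<open>g\<^sub>* G\<close>.\<close>
  then obtain \<epsilon> where \<epsilon>: "edgewise_iso Y ?PY ?w (path_unit Y) \<epsilon>"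
    using edgewise_iso_equivclp[OF PY Y w] unfolding homotopic_def by blast
  have "natural_iso ?PY ?PY (comp_functor ?PY ?F G) (id_functor ?PY) \<epsilon>"
  proof (rule natural_iso_path_categoryI[OF Y PY comp_functor_in[OF PY G F] id_functor_in[OF PY]])
    have id_ob: "fob (id_functor ?PY) y = vertex_value (path_unit Y) y"
      and FG_ob: "fob (comp_functor ?PY ?F G) y = vertex_value ?w y"
      if "y \<in> simps Y 0" for y
      using that smap_in[OF u that]
      by (simp add: id_functor_def vertex_value_unit[OF Y],
          simp add: comp_functor_def compose_def G_ob vertex_value_def smap_comp_apply fob_nerve_map)
    show "iso_in ?PY (fob (comp_functor ?PY ?F G) y) (fob (id_functor ?PY) y) (\<epsilon> y)"
      if "y \<in> simps Y 0" for y
      using \<epsilon> that unfolding edgewise_iso_def by (simp add: id_ob FG_ob)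
    fix e
    assume e: "e \<in> simps Y 1"
    let ?e = "path_class Y (src Y e) (tgt Y e) [e]"
    have ue: "fob (u 1 e) 0 = vertex_value u (src Y e)" "fob (u 1 e) 1 = vertex_value u (tgt Y e)"
      using fob_smap_nerve[OF u e] by simp_all
    have "(src Y e, tgt Y e, ?e) \<in> arrows ?PY"
      using ends[OF Y e] arrow[OF Y e] by simp
    then have "fmor (id_functor ?PY) (src Y e, tgt Y e, ?e) = edge_value (path_unit Y) e"
      and "fmor (comp_functor ?PY ?F G) (src Y e, tgt Y e, ?e) = edge_value ?w e"
      using G_edge[OF e] G_ob ends[OF Y e] ue fmor_nerve_map[OF smap_in[OF u e], of 0 1 ?F] e
      by (simp add: id_functor_def edge_value_unit[OF Y e],
          simp add: comp_functor_def edge_value_def smap_comp_apply)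
    then show "cmp ?PY (fob (comp_functor ?PY ?F G) (src Y e)) (fob (comp_functor ?PY ?F G) (tgt Y e))
          (fob (id_functor ?PY) (tgt Y e)) (\<epsilon> (tgt Y e))
          (fmor (comp_functor ?PY ?F G) (src Y e, tgt Y e, ?e)) =
        cmp ?PY (fob (comp_functor ?PY ?F G) (src Y e)) (fob (id_functor ?PY) (src Y e))
          (fob (id_functor ?PY) (tgt Y e))
          (fmor (id_functor ?PY) (src Y e, tgt Y e, ?e)) (\<epsilon> (src Y e))"
      using \<epsilon> e ends[OF Y e] unfolding edgewise_iso_def by (simp only: id_ob FG_ob)
  qed
  ultimately show ?thesis
    unfolding equivalence_of_categories_def using PX PY F G by blast
qed

end
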